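(* For any integer $d\ge3$, there exist constants $C_d^*,c_d^*>0$ such that the following holds. For $\varepsilon>0$, let $K=K(\varepsilon)=C_d^*\exp\big(c_d^*\sqrt{\log(1/\varepsilon)}\big)$. Then for all $n\in\mathbb{N}_1$, if $T_n\sim\mathrm{UA}_d(n)$, it holds that $\mathbb{P}(\text{\o}\notin\mathcal{A}_K(T_n))\le\varepsilon$.
   Context: $d$-regular uniform attachment model ($d\ge3$): $T_1$ consists of a root node \o{} and $d$ leaves adjacent to it; for each $n\ge1$, $T_{n+1}$ is obtained from $T_n$ by adding $d-1$ new neighbours to a single leaf $V_n$ of $T_n$, chosen uniformly at random among the leaves of $T_n$, independently of previous choices. We write $T_n\sim\mathrm{UA}_d(n)$. Centrality: for a finite tree $T=(V,E)$ and $u\in V$, let $(T,u)_{v\downarrow}$ denote the subtree consisting of $v$ and its descendants when $T$ is rooted at $u$; set $\varphi_T(u)=\prod_{v\in V\setminus\{u\}}|(T,u)_{v\downarrow}|$. The algorithm $\mathcal{A}_k$ ($k$ a positive integer): given an unlabeled finite tree $T$ with $n$ nodes, order its nodes $v_1,\dots,v_n$ so that $\varphi_T(v_1)\le\dots\le\varphi_T(v_n)$ (ties broken arbitrarily) and output $\{v_1,\dots,v_{k\wedge n}\}$. For non-integer $K$, $\mathcal{A}_K$ is understood as $\mathcal{A}_{\lceil K\rceil}$. *)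

theory Defs
  imports "HOL-Probability.Probability"
begin

section \<open>Finite trees\<close>

record 'a graph =
  verts :: "'a set"
  edges :: "'a set set"

definition vertex_degree :: "'a graph \<Rightarrow> 'a \<Rightarrow> nat" where
  "vertex_degree G v = card {e \<in> edges G. v \<in> e}"

definition is_path :: "'a graph \<Rightarrow> 'a \<Rightarrow> 'a list \<Rightarrow> 'a \<Rightarrow> bool" where
  "is_path G u p w \<longleftrightarrow>
     p \<noteq> [] \<and> hd p = u \<and> last p = w \<and> distinct p \<and> set p \<subseteq> verts G \<and>
     successively (\<lambda>x y. {x, y} \<in> edges G) p"

definition finite_tree :: "'a graph \<Rightarrow> bool" where
  "finite_tree T \<longleftrightarrow>
     finite (verts T) \<and> verts T \<noteq> {} \<and>
     (\<forall>e \<in> edges T. \<exists>x \<in> verts T. \<exists>y \<in> verts T. x \<noteq> y \<and> e = {x, y}) \<and>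
     (\<forall>u \<in> verts T. \<forall>w \<in> verts T. \<exists>!p. is_path T u p w)"

definition leaves :: "'a graph \<Rightarrow> 'a set" where
  "leaves T = {v \<in> verts T. vertex_degree T v = 1}"


section \<open>The d-regular uniform attachment model\<close>

text \<open>The nodes are natural numbers, numbered in order of appearance, so that every
  tree generated below has vertex set \<open>{..<N}\<close> and \<open>N\<close> is the first fresh label.\<close>

definition root_node :: nat where
  "root_node = 0"

definition star :: "nat \<Rightarrow> nat graph" where
  "star d = \<lparr> verts = insert root_node {1..d}, edges = {{root_node, i} | i. i \<in> {1..d}} \<rparr>"

definition attach :: "nat \<Rightarrow> nat \<Rightarrow> nat graph \<Rightarrow> nat graph" where
  "attach m v T =
     (let new = {card (verts T)..<card (verts T) + m} in
      \<lparr> verts = verts T \<union> new, edges = edges T \<union> {{v, w} | w. w \<in> new} \<rparr>)"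

definition UA_step :: "nat \<Rightarrow> nat graph \<Rightarrow> nat graph pmf" where
  "UA_step d T = map_pmf (\<lambda>v. attach (d - 1) v T) (pmf_of_set (leaves T))"

text \<open>The law of the \<open>n\<close>-th tree, for \<open>n \<ge> 1\<close>: the first tree is the star
  (\<open>n = 0\<close> is a dummy index).\<close>

definition UA :: "nat \<Rightarrow> nat \<Rightarrow> nat graph pmf" where
  "UA d n = ((\<lambda>p. bind_pmf p (UA_step d)) ^^ (n - 1)) (return_pmf (star d))"


section \<open>Centrality and the root-finding algorithm\<close>

text \<open>In a tree, \<open>w\<close> is \<open>v\<close> or a descendant of \<open>v\<close> with respect to the root \<open>u\<close> iff
  the unique path from \<open>u\<close> to \<open>w\<close> passes through \<open>v\<close>.\<close>

definition descendants :: "'a graph \<Rightarrow> 'a \<Rightarrow> 'a \<Rightarrow> 'a set" where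
  "descendants T u v = {w \<in> verts T. \<exists>p. is_path T u p w \<and> v \<in> set p}"

definition centrality :: "'a graph \<Rightarrow> 'a \<Rightarrow> nat" where
  "centrality T u = (\<Prod>v \<in> verts T - {u}. card (descendants T u v))"

text \<open>The possible outputs of the algorithm on \<open>T\<close>, one for each way of breaking ties;
  \<open>take k\<close> returns the whole list if it has fewer than \<open>k\<close> elements.\<close>

definition algorithm_outputs :: "nat \<Rightarrow> 'a graph \<Rightarrow> 'a set set" where
  "algorithm_outputs k T =
     {set (take k vs) | vs. distinct vs \<and> set vs = verts T \<and> sorted (map (centrality T) vs)}"

text \<open>A version of the algorithm for some rule of breaking ties. The rule is arbitrary: it
  may be randomized and may depend on the labels. The former includes every procedure whose
  input is the unlabelled tree, such as breaking ties after a uniformly random relabelling.\<close>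

definition is_algorithm :: "nat \<Rightarrow> ('a graph \<Rightarrow> 'a set pmf) \<Rightarrow> bool" where
  "is_algorithm k A \<longleftrightarrow> (\<forall>T. finite_tree T \<longrightarrow> set_pmf (A T) \<subseteq> algorithm_outputs k T)"

end

theory Submission
  imports Defs
begin

text \<open>
  Along the path from the root to a node \<open>v\<close>, the centrality of the root divided by that of \<open>v\<close> is the
  product of the odds \<open>s / (N - s)\<close>, where \<open>s\<close> runs through the sizes of the subtrees hanging from the
  path and \<open>N\<close> is the size of the tree.

  Probabilistic part: the subtree sizes form Polya urns, so the expectation of the sum over all \<open>v\<close> of
  the products of \<open>2 * sqrt (s / (N - s))\<close> solves an explicit one-dimensional recursion and is bounded by a
  constant \<open>C0\<close> independently of the time. By Markov's inequality this sum is at most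
  \<open>M = C0 / \<epsilon>\<close> with probability at least \<open>1 - \<epsilon>\<close>.

  Deterministic part: if the sum is at most \<open>M\<close>, a node \<open>v\<close> at least as central as the root satisfies
  \<open>\<Prod> s / (2 * N) \<ge> M powr (- 4)\<close> along its path. For every \<open>0 < \<eta> \<le> 1\<close>, the sum over all nodes of the
  products of \<open>(s / (2 * N)) powr \<eta>\<close> is at most \<open>exp (O (1 / \<eta>))\<close>, so there are at most
  \<open>exp (4 * \<eta> * ln M + O (1 / \<eta>))\<close> such nodes. The choice \<open>\<eta> = 1 / (1 + sqrt (ln (1 / \<epsilon>)))\<close> balances
  the two terms.
\<close>

section \<open>Paths in finite trees\<close>

text \<open>A product of odds that is at least 1 does not by itself bound the product of
  \<open>s / N\<close> from below: the odds are unbounded as \<open>s\<close> approaches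
  \<open>N\<close>, so a few huge factors near the root could compensate for many small ones, and
  replacing odds by \<open>s / (2 * N)\<close> costs a constant factor per node. The weighted sum
  controls both losses. Its square roots make the rates in the recursion comparable to
  \<open>1 / sqrt (l * (n - l))\<close>, which is summable uniformly in \<open>n\<close> at both
  ends; the exponents 0 and 1 would each leave a logarithm. Its factor 2 becomes, after squaring, a
  factor 4 per node, so the bound also limits the length of the path once the product of the odds is
  at least 1. Each loss costs \<open>M ^ 2\<close>, whence the exponent 4. In the deterministic
  part, the 1/2 in \<open>s / (2 * N)\<close> keeps every weight below 1 by a multiple of
  \<open>\<eta>\<close>, even for a subtree that fills almost the whole tree.\<close>

lemma is_path_rev: "is_path G u p w \<longleftrightarrow> is_path G w (rev p) u"
proof -
  have "successively (\<lambda>x y. {x, y} \<in> edges G) (rev p) \<longleftrightarrow> successively (\<lambda>x y. {x, y} \<in> edges G) p"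
    by (simp add: successively_rev insert_commute)
  then show ?thesis
    by (cases "p = []") (auto simp: is_path_def hd_rev last_rev)
qed

lemma is_path_refl_iff: "is_path G u p u \<longleftrightarrow> p = [u] \<and> u \<in> verts G"
proof
  assume p: "is_path G u p u"
  then obtain q where q: "p = u # q" by (cases p) (auto simp: is_path_def)
  have "q = []"
  proof (rule ccontr)
    assume "q \<noteq> []"
    then have "u \<in> set q" using p q by (metis is_path_def last.simps last_in_set)
    then show False using p q by (simp add: is_path_def)
  qed
  then show "p = [u] \<and> u \<in> verts G" using p q by (simp add: is_path_def)
qed (auto simp: is_path_def)

lemma is_path_Cons_Cons:
  "is_path G u (u # v # q) w \<longleftrightarrow>
     u \<in> verts G \<and> u \<notin> set (v # q) \<and> {u, v} \<in> edges G \<and> is_path G v (v # q) w"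
  by (auto simp: is_path_def)

lemma is_path_Cons:
  assumes "is_path G v q w" "u \<in> verts G" "u \<notin> set q" "{u, v} \<in> edges G"
  shows "is_path G u (u # q) w"
  using assms by (cases q) (auto simp: is_path_def)

lemma is_path_append_left:
  assumes "is_path G u (p @ x # q) w"
  shows "is_path G u (p @ [x]) x"
  using assms by (auto simp: is_path_def successively_append_iff hd_append)

lemma finite_tree_ex1_path:
  "finite_tree T \<Longrightarrow> u \<in> verts T \<Longrightarrow> w \<in> verts T \<Longrightarrow> \<exists>!p. is_path T u p w"
  by (simp add: finite_tree_def)

lemma finite_tree_path_unique:
  "finite_tree T \<Longrightarrow> u \<in> verts T \<Longrightarrow> w \<in> verts T \<Longrightarrow> is_path T u p w \<Longrightarrow> is_path T u q w \<Longrightarrow> p = q"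
  using ex1_implies_ex[OF finite_tree_ex1_path] the1_equality[OF finite_tree_ex1_path] by metis

lemma finite_tree_path_exists:
  "finite_tree T \<Longrightarrow> u \<in> verts T \<Longrightarrow> w \<in> verts T \<Longrightarrow> \<exists>p. is_path T u p w"
  by (rule ex1_implies_ex[OF finite_tree_ex1_path])

lemma descendants_iff:
  assumes "finite_tree T" "u \<in> verts T" "is_path T u p w" "w \<in> verts T"
  shows "w \<in> descendants T u v \<longleftrightarrow> v \<in> set p"
  unfolding descendants_def using finite_tree_path_unique[OF assms(1,2)] assms by auto

text \<open>If \<open>v\<close> is off the path from \<open>u\<close>, prepending \<open>v\<close>
  gives a path; if it is on that path, uniqueness forces the initial segment up to \<open>v\<close>
  to be the edge itself.\<close>

lemma adjacent_paths:
  assumes T: "finite_tree T" and u: "u \<in> verts T" and v: "v \<in> verts T" and uv: "u \<noteq> v"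
    and e: "{u, v} \<in> edges T" and w: "w \<in> verts T"
  obtains p where "is_path T v p w" "is_path T u (u # p) w" "v \<in> set p" "u \<notin> set p"
    | p where "is_path T u p w" "is_path T v (v # p) w" "u \<in> set p" "v \<notin> set p"
proof -
  obtain p where p: "is_path T u p w" using finite_tree_path_exists[OF T u w] by blast
  have up: "u \<in> set p" using p unfolding is_path_def by (metis list.set_sel(1))
  show thesis
  proof (cases "v \<in> set p")
    case False
    have "is_path T v (v # p) w"
      using is_path_Cons[OF p v False] e by (simp add: insert_commute)
    then show thesis using that(2) p up False by blast
  next
    case True
    then obtain a b where ab: "p = a @ v # b" by (meson split_list)
    have "is_path T u (a @ [v]) v" using is_path_append_left p ab by metis
    moreover have "is_path T u [u, v] v" using u v uv e by (simp add: is_path_def)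
    ultimately have "a @ [v] = [u, v]" using finite_tree_path_unique[OF T u v] by blast
    then have "p = u # v # b" using ab by simp
    then show thesis using that(1)[of "v # b"] p is_path_Cons_Cons[of T u v b w] by simp
  qed
qed

text \<open>Moving the root across an edge adds or removes one endpoint of that edge at the start of
  each path, so no other membership changes.\<close>

lemma
  assumes T: "finite_tree T" and u: "u \<in> verts T" and v: "v \<in> verts T" and uv: "u \<noteq> v"
    and e: "{u, v} \<in> edges T"
  shows descendants_adjacent_other: "\<And>x. x \<noteq> u \<Longrightarrow> x \<noteq> v \<Longrightarrow> descendants T u x = descendants T v x"
    and descendants_adjacent_Un: "descendants T u v \<union> descendants T v u = verts T"
    and descendants_adjacent_Int: "descendants T u v \<inter> descendants T v u = {}"
proof -
  have *: "(w \<in> descendants T u x \<longleftrightarrow> w \<in> descendants T v x) \<and>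
      (w \<in> descendants T u v \<longleftrightarrow> w \<notin> descendants T v u)"
    if w: "w \<in> verts T" and x: "x \<noteq> u" "x \<noteq> v" for x w
    by (rule adjacent_paths[OF T u v uv e w]; use that uv in
        \<open>auto simp: descendants_iff[OF T u _ w] descendants_iff[OF T v _ w]\<close>)
  have **: "w \<in> descendants T u v \<longleftrightarrow> w \<notin> descendants T v u" if w: "w \<in> verts T" for w
    by (rule adjacent_paths[OF T u v uv e w]; use that uv in
        \<open>auto simp: descendants_iff[OF T u _ w] descendants_iff[OF T v _ w]\<close>)
  have sub: "descendants T a b \<subseteq> verts T" for a b by (auto simp: descendants_def)
  show "descendants T u x = descendants T v x" if "x \<noteq> u" "x \<noteq> v" for x
    using * that sub by blast
  show "descendants T u v \<union> descendants T v u = verts T"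
    "descendants T u v \<inter> descendants T v u = {}"
    using ** sub by blast+
qed

lemma centrality_adjacent:
  assumes T: "finite_tree T" and u: "u \<in> verts T" and v: "v \<in> verts T" and uv: "u \<noteq> v"
    and e: "{u, v} \<in> edges T"
  shows "centrality T u * card (descendants T v u) = centrality T v * card (descendants T u v)"
proof -
  have fin: "finite (verts T)" using T by (simp add: finite_tree_def)
  have 1: "centrality T u = card (descendants T u v) * (\<Prod>x\<in>verts T - {u} - {v}. card (descendants T u x))"
    unfolding centrality_def using fin v uv by (intro prod.remove) auto
  have 2: "centrality T v = card (descendants T v u) * (\<Prod>x\<in>verts T - {v} - {u}. card (descendants T v x))"
    unfolding centrality_def using fin u uv by (intro prod.remove) auto
  have 3: "(\<Prod>x\<in>verts T - {u} - {v}. card (descendants T u x)) = (\<Prod>x\<in>verts T - {v} - {u}. card (descendants T v x))"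
    by (rule prod.cong) (auto simp: descendants_adjacent_other[OF assms])
  show ?thesis unfolding 1 2 3 by simp
qed

lemma card_descendants_adjacent:
  assumes T: "finite_tree T" and u: "u \<in> verts T" and v: "v \<in> verts T" and uv: "u \<noteq> v"
    and e: "{u, v} \<in> edges T"
  shows "card (descendants T v u) + card (descendants T u v) = card (verts T)"
proof -
  have "finite (verts T)" using T by (simp add: finite_tree_def)
  then have "finite (descendants T u v)" "finite (descendants T v u)" by (auto simp: descendants_def)
  then show ?thesis
    using card_Un_disjoint[of "descendants T u v" "descendants T v u"]
      descendants_adjacent_Un[OF assms] descendants_adjacent_Int[OF assms] by simp
qed

lemma centrality_pos:
  assumes T: "finite_tree T" and u: "u \<in> verts T"
  shows "centrality T u > 0"
proof -
  have fin: "finite (verts T)" using T by (simp add: finite_tree_def)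
  have "card (descendants T u v) > 0" if v: "v \<in> verts T" for v
  proof -
    obtain p where p: "is_path T u p v" using finite_tree_path_exists[OF T u v] by blast
    then have "v \<in> set p" unfolding is_path_def by (metis last_in_set)
    then have "v \<in> descendants T u v" using descendants_iff[OF T u p v] by blast
    moreover have "finite (descendants T u v)" using fin by (auto simp: descendants_def)
    ultimately show ?thesis by (auto simp: card_gt_0_iff)
  qed
  then show ?thesis unfolding centrality_def by (intro prod_pos) blast
qed

section \<open>Attaching one leaf to a tree\<close>

definition add_leaf :: "'a \<Rightarrow> 'a \<Rightarrow> 'a graph \<Rightarrow> 'a graph" where
  "add_leaf q x T = \<lparr> verts = insert x (verts T), edges = insert {q, x} (edges T) \<rparr>"

text \<open>The new node has a single neighbour, whereas an interior node of a path has two. Hence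
  paths between old nodes avoid \<open>x\<close>, and a path from \<open>x\<close> to an old node is
  an old path from \<open>q\<close> with \<open>x\<close> in front.\<close>

lemma finite_tree_add_leaf:
  assumes T: "finite_tree T" and q: "q \<in> verts T" and x: "x \<notin> verts T"
  shows "finite_tree (add_leaf q x T)"
proof -
  let ?T = "add_leaf q x T"
  have fin: "finite (verts T)" using T by (simp add: finite_tree_def)
  have edge: "\<exists>a\<in>verts T. \<exists>b\<in>verts T. a \<noteq> b \<and> e = {a, b}" if "e \<in> edges T" for e
    using T that by (simp add: finite_tree_def)
  have edges_sub: "a \<in> verts T \<and> b \<in> verts T" if ab: "{a, b} \<in> edges T" for a b
  proof -
    obtain c d where cd: "c \<in> verts T" "d \<in> verts T" "{a, b} = {c, d}"
      using edge[OF ab] by blast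
    then show ?thesis by (auto simp: doubleton_eq_iff)
  qed
  have nbr_x: "a = q" if "{a, x} \<in> edges ?T" for a
    using that edges_sub[of a x] x by (auto simp: add_leaf_def doubleton_eq_iff)
  have nbr_x': "a = q" if "{x, a} \<in> edges ?T" for a
    using that nbr_x[of a] by (simp add: insert_commute)
  have qx: "q \<noteq> x" using q x by blast
  have no_x: "x \<notin> set p" if p: "is_path ?T u p w" and "u \<noteq> x" "w \<noteq> x" for u p w
  proof
    assume "x \<in> set p"
    then obtain a b where ab: "p = a @ x # b" by (meson split_list)
    have "a \<noteq> []" using p ab that by (auto simp: is_path_def)
    then obtain a' y where a: "a = a' @ [y]" by (metis rev_exhaust)
    have "b \<noteq> []" using p ab that by (auto simp: is_path_def)
    then obtain z b' where b: "b = z # b'" by (metis list.exhaust)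
    have "{y, x} \<in> edges ?T" "{x, z} \<in> edges ?T" "y \<noteq> z"
      using p unfolding ab a b is_path_def by (auto simp: successively_append_iff)
    then show False using nbr_x nbr_x' by blast
  qed
  have old: "is_path ?T u p w \<longleftrightarrow> is_path T u p w" if "u \<in> verts T" "w \<in> verts T" for u p w
  proof
    assume p: "is_path ?T u p w"
    have nx: "x \<notin> set p" using no_x[OF p] that x by blast
    have "successively (\<lambda>x y. {x, y} \<in> edges T) p"
    proof (rule successively_mono[where P = "\<lambda>a b. {a, b} \<in> edges ?T"])
      show "successively (\<lambda>a b. {a, b} \<in> edges ?T) p" using p by (simp add: is_path_def)
    next
      fix a b assume "a \<in> set p" "b \<in> set p" "{a, b} \<in> edges ?T"
      then show "{a, b} \<in> edges T" using nx by (auto simp: add_leaf_def doubleton_eq_iff)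
    qed
    then show "is_path T u p w" using p nx by (auto simp: is_path_def add_leaf_def)
  next
    assume p: "is_path T u p w"
    then have "successively (\<lambda>x y. {x, y} \<in> edges ?T) p"
      unfolding is_path_def by (auto intro: successively_mono simp: add_leaf_def)
    then show "is_path ?T u p w" using p by (auto simp: is_path_def add_leaf_def)
  qed
  have new: "\<exists>!p. is_path ?T x p w" if w: "w \<in> verts T" for w
  proof -
    obtain p where p: "is_path T q p w" using finite_tree_path_exists[OF T q w] by blast
    then have "x \<notin> set p" using x by (auto simp: is_path_def)
    moreover have "is_path ?T q p w" using p old[OF q w] by simp
    ultimately have 1: "is_path ?T x (x # p) w"
      by (intro is_path_Cons[of _ q]) (auto simp: add_leaf_def)
    have 2: "p' = x # p" if p': "is_path ?T x p' w" for p'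
    proof -
      obtain p1 where p1: "p' = x # p1" using p' by (cases p') (auto simp: is_path_def)
      have "p1 \<noteq> []" using p1 p' w x by (auto simp: is_path_def)
      then obtain y p2 where p2: "p1 = y # p2" by (metis list.exhaust)
      have y: "{x, y} \<in> edges ?T" "is_path ?T y p1 w"
        using p' unfolding p1 p2 is_path_Cons_Cons by blast+
      then have "y = q" using nbr_x' by blast
      then have "is_path T q p1 w" using y old q w by blast
      then show ?thesis using finite_tree_path_unique[OF T q w p] p1 by blast
    qed
    show ?thesis using 1 2 by blast
  qed
  have rev: "\<exists>!p. is_path ?T w p u" if "\<exists>!p. is_path ?T u p w" for u w
  proof -
    from that obtain p where p: "is_path ?T u p w" and uniq: "\<And>p'. is_path ?T u p' w \<Longrightarrow> p' = p"
      by (elim ex1E) blast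
    show ?thesis
    proof (rule ex1I[of _ "rev p"])
      show "is_path ?T w (rev p) u" using p is_path_rev[of ?T u p w] by simp
      fix p' assume "is_path ?T w p' u"
      then have "is_path ?T u (rev p') w" using is_path_rev[of ?T w p' u] by simp
      then show "p' = rev p" using uniq[of "rev p'"] by auto
    qed
  qed
  have "\<exists>!p. is_path ?T u p w" if "u \<in> verts ?T" "w \<in> verts ?T" for u w
  proof (cases "u = x")
    case True
    show ?thesis
    proof (cases "w = x")
      case True
      then show ?thesis using \<open>u = x\<close> by (auto simp: is_path_refl_iff add_leaf_def)
    next
      case False
      then show ?thesis using \<open>u = x\<close> new that by (simp add: add_leaf_def)
    qed
  next
    case False
    then have u: "u \<in> verts T" using that by (simp add: add_leaf_def)
    show ?thesis
    proof (cases "w = x")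
      case True
      then show ?thesis using new[OF u] rev by blast
    next
      case False
      then have w: "w \<in> verts T" using that by (simp add: add_leaf_def)
      have "\<exists>!p. is_path T u p w" using T u w unfolding finite_tree_def by simp
      then show ?thesis by (simp only: old[OF u w])
    qed
  qed
  moreover have "\<forall>e\<in>edges ?T. \<exists>a\<in>verts ?T. \<exists>b\<in>verts ?T. a \<noteq> b \<and> e = {a, b}"
  proof
    fix e assume "e \<in> edges ?T"
    then consider "e = {q, x}" | "e \<in> edges T" by (auto simp: add_leaf_def)
    then show "\<exists>a\<in>verts ?T. \<exists>b\<in>verts ?T. a \<noteq> b \<and> e = {a, b}"
    proof cases
      case 1
      then show ?thesis using q qx by (auto simp: add_leaf_def)
    next
      case 2
      then obtain a b where "a \<in> verts T" "b \<in> verts T" "a \<noteq> b" "e = {a, b}"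
        using edge by blast
      then show ?thesis by (auto simp: add_leaf_def)
    qed
  qed
  moreover have "finite (verts ?T)" "verts ?T \<noteq> {}" using fin by (auto simp: add_leaf_def)
  ultimately show ?thesis unfolding finite_tree_def by blast
qed


section \<open>Trees as parent lists\<close>

text \<open>A tree is encoded by the list of the parents of its nodes; the root \<open>0\<close> has the dummy
  parent \<open>0\<close>.\<close>

definition parent_list :: "nat list \<Rightarrow> bool" where
  "parent_list P \<longleftrightarrow> P \<noteq> [] \<and> P ! 0 = 0 \<and> (\<forall>w. 0 < w \<and> w < length P \<longrightarrow> P ! w < w)"

definition graph_of :: "nat list \<Rightarrow> nat graph" where
  "graph_of P = \<lparr> verts = {..<length P}, edges = {{P ! w, w} | w. 0 < w \<and> w < length P} \<rparr>"

text \<open>The root is excluded; the comparison in the guard only serves termination.\<close>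

function anc :: "nat list \<Rightarrow> nat \<Rightarrow> nat list" where
  "anc P w = (if w = 0 \<or> w \<le> P ! w then [] else w # anc P (P ! w))"
  by pat_completeness auto
termination by (relation "Wellfounded.measure snd") auto

declare anc.simps [simp del]

text \<open>For \<open>v = 0\<close> this is empty, because ancestor lists omit the root; statements
  that cover the root treat it separately.\<close>

definition subtree :: "nat list \<Rightarrow> nat \<Rightarrow> nat set" where
  "subtree P v = {w. w < length P \<and> v \<in> set (anc P w)}"

lemma anc_0 [simp]: "anc P 0 = []"
  by (simp add: anc.simps)

lemma anc_pos: "parent_list P \<Longrightarrow> 0 < w \<Longrightarrow> w < length P \<Longrightarrow> anc P w = w # anc P (P ! w)"
  by (subst anc.simps) (auto simp: parent_list_def)

lemma parent_less: "parent_list P \<Longrightarrow> 0 < w \<Longrightarrow> w < length P \<Longrightarrow> P ! w < w"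
  by (simp add: parent_list_def)

lemma parent_less_length: "parent_list P \<Longrightarrow> w < length P \<Longrightarrow> P ! w < length P"
  by (cases "w = 0") (auto simp: parent_list_def intro: less_trans)

lemma parent_list_induct [consumes 2, case_names root node]:
  assumes "parent_list P" "w < length P"
    and "Q 0"
    and "\<And>w. 0 < w \<Longrightarrow> w < length P \<Longrightarrow> P ! w < w \<Longrightarrow> anc P w = w # anc P (P ! w) \<Longrightarrow> Q (P ! w) \<Longrightarrow> Q w"
  shows "Q w"
  using assms(2)
proof (induction w rule: less_induct)
  case (less w)
  show ?case
  proof (cases "w = 0")
    case False
    then have "P ! w < w" using parent_less[OF assms(1)] less.prems by simp
    then show ?thesis
      using assms(4)[of w] less False anc_pos[OF assms(1)] by simp
  qed (simp add: assms(3))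
qed

lemma anc_bounds: "x \<in> set (anc P w) \<Longrightarrow> 0 < x \<and> x \<le> w"
proof (induction P w rule: anc.induct)
  case (1 P w)
  show ?case
  proof (cases "w = 0 \<or> w \<le> P ! w")
    case True
    then show ?thesis using 1(2) by (simp add: anc.simps)
  next
    case False
    then have "x = w \<or> x \<in> set (anc P (P ! w))" using 1(2) by (subst (asm) anc.simps) auto
    then show ?thesis using 1(1) False by fastforce
  qed
qed

lemma anc_self: "parent_list P \<Longrightarrow> 0 < w \<Longrightarrow> w < length P \<Longrightarrow> w \<in> set (anc P w)"
  by (simp add: anc_pos)

lemma anc_subset:
  assumes P: "parent_list P" and w: "w < length P" and "x \<in> set (anc P w)"
  shows "set (anc P x) \<subseteq> set (anc P w)"
  using P w assms(3)
proof (induction w rule: parent_list_induct)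
  case (node w)
  then show ?case using anc_pos[OF P] by auto
qed simp

lemma distinct_anc:
  assumes P: "parent_list P" and w: "w < length P"
  shows "distinct (anc P w)"
  using P w
proof (induction w rule: parent_list_induct)
  case (node w)
  then show ?case using anc_bounds by fastforce
qed simp

lemma anc_in_parents:
  assumes P: "parent_list P" and w: "w < length P" and "x \<in> set (anc P w)" "x \<noteq> w"
  shows "x \<in> set P"
  using P w assms(3,4)
proof (induction w rule: parent_list_induct)
  case (node w)
  have "P ! w \<in> set P" using node by simp
  then show ?case using node by (cases "x = P ! w") auto
qed simp

text \<open>A node on the path of \<open>P ! w\<close> has a label of at most \<open>P ! w\<close>,
  hence a parent with a smaller label, so it is no sibling of \<open>w\<close>. This makes the
  subtrees of siblings disjoint.\<close>

lemma anc_siblings_eq: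
  assumes P: "parent_list P" and w: "w < length P"
    and "x \<in> set (anc P w)" "y \<in> set (anc P w)" "P ! x = P ! y"
  shows "x = y"
  using P w assms(3-5)
proof (induction w rule: parent_list_induct)
  case (node w)
  have *: False if "z \<in> set (anc P (P ! w))" "P ! z = P ! w" for z
  proof -
    have "0 < z" "z \<le> P ! w" using anc_bounds[OF that(1)] by auto
    then show False using parent_less[OF P, of z] that(2) node by auto
  qed
  show ?case using node * by fastforce
qed simp

lemma anc_append:
  assumes P: "parent_list P" and w: "w < length P"
  shows "anc (P @ Q) w = anc P w"
  using P w
proof (induction w rule: parent_list_induct)
  case (node w)
  then show ?case by (subst anc.simps) (simp add: nth_append)
qed simp

lemma parent_list_append_replicate:
  assumes "parent_list P" "v < length P"
  shows "parent_list (P @ replicate m v)"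
  using assms by (auto simp: parent_list_def nth_append)

lemma finite_subtree [simp]: "finite (subtree P v)"
  by (simp add: subtree_def)

lemma subtree_sub: "subtree P v \<subseteq> {..<length P}"
  by (auto simp: subtree_def)

lemma subtree_mono:
  assumes P: "parent_list P" and w: "w < length P" and "x \<in> set (anc P w)"
  shows "subtree P w \<subseteq> subtree P x"
  using anc_subset[OF P] assms(3) by (auto simp: subtree_def)

lemma edges_graph_of: "edges (graph_of P) = (\<lambda>w. {P ! w, w}) ` {0<..<length P}"
  by (auto simp: graph_of_def)

text \<open>The last entry is the parent of the node with the largest label, which is a leaf;
  removing it drives the induction.\<close>

lemma finite_tree_graph_of: "parent_list P \<Longrightarrow> finite_tree (graph_of P)"
proof (induction P rule: rev_induct)
  case (snoc q P)
  show ?case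
  proof (cases "P = []")
    case True
    have "graph_of (P @ [q]) = \<lparr>verts = {0}, edges = {}\<rparr>"
      using True by (auto simp: graph_of_def)
    then show ?thesis by (auto simp: finite_tree_def is_path_refl_iff)
  next
    case False
    have old: "P ! w = (P @ [q]) ! w" if "w < length P" for w using that by (simp add: nth_append)
    have P: "parent_list P"
      using snoc.prems False unfolding parent_list_def
      by (metis old length_append_singleton length_greater_0_conv less_SucI)
    have "(P @ [q]) ! length P < length P"
      using parent_less[OF snoc.prems, of "length P"] False by simp
    then have q: "q < length P" by simp
    have "{0<..<length (P @ [q])} = insert (length P) {0<..<length P}" using False by auto
    then have "edges (graph_of (P @ [q])) = insert {q, length P} (edges (graph_of P))"
      unfolding edges_graph_of by (simp add: old[symmetric])
    then have "graph_of (P @ [q]) = add_leaf q (length P) (graph_of P)"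
      by (auto simp: add_leaf_def graph_of_def)
    moreover have "finite_tree (add_leaf q (length P) (graph_of P))"
      using snoc.IH[OF P] q by (intro finite_tree_add_leaf) (auto simp: graph_of_def)
    ultimately show ?thesis by simp
  qed
qed (simp add: parent_list_def)

lemma is_path_graph_of:
  assumes P: "parent_list P" and w: "w < length P"
  shows "is_path (graph_of P) w (anc P w @ [0]) 0"
  using P w
proof (induction w rule: parent_list_induct)
  case root
  then show ?case using P by (simp add: is_path_def graph_of_def parent_list_def)
next
  case (node w)
  have "w \<notin> set (anc P (P ! w) @ [0])" using node anc_bounds by fastforce
  moreover have "{w, P ! w} \<in> edges (graph_of P)"
    using node by (auto simp: graph_of_def insert_commute)
  ultimately show ?case
    using is_path_Cons[OF node(5), of w] node by (simp add: graph_of_def)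
qed

text \<open>The induction moves the root of the tree from \<open>0\<close> to \<open>u\<close> along
  edges whose endpoints have labels at most \<open>u\<close>, hence different from \<open>x\<close>;
  such moves preserve the descendants of \<open>x\<close>. The case of interest is
  \<open>u = P ! x\<close>.\<close>

lemma descendants_graph_of:
  assumes P: "parent_list P" and u: "u < length P" and x: "u < x"
  shows "descendants (graph_of P) u x = subtree P x"
  using P u x
proof (induction u rule: parent_list_induct)
  case root
  have T: "finite_tree (graph_of P)" using finite_tree_graph_of[OF P] .
  have sub: "descendants (graph_of P) 0 x \<subseteq> {..<length P}" by (auto simp: descendants_def graph_of_def)
  have "w \<in> descendants (graph_of P) 0 x \<longleftrightarrow> x \<in> set (anc P w)" if w: "w < length P" for w
  proof -
    have "is_path (graph_of P) 0 (rev (anc P w @ [0])) w"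
      using is_path_graph_of[OF P w] is_path_rev by metis
    from descendants_iff[OF T _ this] show ?thesis
      using w root P by (auto simp: graph_of_def parent_list_def)
  qed
  then show ?case using sub by (auto simp: subtree_def)
next
  case (node u)
  have T: "finite_tree (graph_of P)" using finite_tree_graph_of[OF P] .
  have "descendants (graph_of P) (P ! u) x = descendants (graph_of P) u x"
    using node by (intro descendants_adjacent_other[OF T]) (auto simp: graph_of_def)
  then show ?case using node by simp
qed

lemma centrality_parent:
  assumes P: "parent_list P" and w: "0 < w" "w < length P"
  shows "centrality (graph_of P) (P ! w) * (length P - card (subtree P w))
      = centrality (graph_of P) w * card (subtree P w)"
proof -
  let ?T = "graph_of P"
  have T: "finite_tree ?T" using finite_tree_graph_of[OF P] .
  have lt: "P ! w < w" using parent_less[OF P w] .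
  have pre: "P ! w \<in> verts ?T" "w \<in> verts ?T" "P ! w \<noteq> w" "{P ! w, w} \<in> edges ?T"
    using w lt by (auto simp: graph_of_def)
  have d: "descendants ?T (P ! w) w = subtree P w"
    using descendants_graph_of[OF P, of "P ! w" w] lt w by simp
  have "card (descendants ?T w (P ! w)) = length P - card (subtree P w)"
    using card_descendants_adjacent[OF T pre] d by (simp add: graph_of_def)
  then show ?thesis using centrality_adjacent[OF T pre] d by simp
qed

lemma card_subtree_less:
  assumes "parent_list P"
  shows "card (subtree P w) < length P"
proof -
  have "subtree P w \<subseteq> {1..<length P}" by (auto simp: subtree_def Suc_le_eq) (use anc_bounds in fastforce)
  then have "card (subtree P w) \<le> card {1..<length P}" by (intro card_mono) auto
  moreover have "length P > 0" using assms by (simp add: parent_list_def)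
  ultimately show ?thesis unfolding card_atLeastLessThan by linarith
qed

text \<open>Telescopes \<open>centrality_parent\<close> along the path to the root. The denominators
  are positive because no subtree contains the root.\<close>

lemma centrality_ratio:
  assumes P: "parent_list P" and w: "w < length P"
  shows "real (centrality (graph_of P) 0) = real (centrality (graph_of P) w) *
    (\<Prod>x\<leftarrow>anc P w. real (card (subtree P x)) / real (length P - card (subtree P x)))"
  using P w
proof (induction w rule: parent_list_induct)
  case (node w)
  have "length P - card (subtree P w) > 0" using card_subtree_less[OF P] by simp
  moreover have "real (centrality (graph_of P) (P ! w)) * real (length P - card (subtree P w))
      = real (centrality (graph_of P) w) * real (card (subtree P w))"
    using centrality_parent[OF P node(1,2)] by (metis of_nat_mult)
  ultimately have "real (centrality (graph_of P) (P ! w)) = real (centrality (graph_of P) w) *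
      (real (card (subtree P w)) / real (length P - card (subtree P w)))"
    by (simp add: field_simps)
  then show ?case using node by (simp add: mult.assoc)
qed simp

lemma sum_card_subtree_children:
  assumes P: "parent_list P" and v: "v < length P"
  shows "(\<Sum>c | 0 < c \<and> c < length P \<and> P ! c = v. card (subtree P c)) \<le>
    (if v = 0 then length P else card (subtree P v))"
proof -
  let ?C = "{c. 0 < c \<and> c < length P \<and> P ! c = v}"
  have "(\<Sum>c\<in>?C. card (subtree P c)) = card (\<Union>c\<in>?C. subtree P c)"
    using anc_siblings_eq[OF P]
    by (subst card_UN_disjoint) (auto simp: subtree_def)
  also have "\<dots> \<le> card (if v = 0 then {..<length P} else subtree P v)"
  proof (rule card_mono)
    have "subtree P c \<subseteq> subtree P v" if "c \<in> ?C" "v \<noteq> 0" for c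
      using that v by (intro subtree_mono[OF P]) (auto simp: anc_pos[OF P])
    then show "(\<Union>c\<in>?C. subtree P c) \<subseteq> (if v = 0 then {..<length P} else subtree P v)"
      using subtree_sub by (intro UN_least) simp
  qed auto
  finally show ?thesis by (simp split: if_splits)
qed


section \<open>The attachment process on parent lists\<close>

definition childless :: "nat list \<Rightarrow> nat set" where
  "childless P = {..<length P} - set P"

definition grow :: "nat \<Rightarrow> nat list \<Rightarrow> nat \<Rightarrow> nat list" where
  "grow d P v = P @ replicate (d - 1) v"

text \<open>The elements of \<open>P\<close> are the internal nodes, because the dummy parent is internal as well.\<close>

definition internals :: "nat list \<Rightarrow> nat \<Rightarrow> nat" where
  "internals P v = card {u \<in> set P. v \<in> set (anc P u)}"

text \<open>The possible outcomes of the process; the time index \<open>n\<close> is also the number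
  of internal nodes. Deterministic facts are proved by induction on this predicate and reach the
  random tree through \<open>set_parent_process\<close>.\<close>

inductive history :: "nat \<Rightarrow> nat \<Rightarrow> nat list \<Rightarrow> bool" for d where
  history_star: "history d 1 (replicate (Suc d) 0)"
| history_grow: "history d n P \<Longrightarrow> v \<in> childless P \<Longrightarrow> history d (Suc n) (grow d P v)"

lemma finite_childless [simp]: "finite (childless P)"
  by (simp add: childless_def)

lemma history_parent_list: "history d n P \<Longrightarrow> parent_list P"
proof (induction rule: history.induct)
  case history_star
  then show ?case by (auto simp: parent_list_def nth_Cons' simp del: replicate_Suc)
next
  case (history_grow n P v)
  then show ?case by (simp add: grow_def parent_list_append_replicate childless_def)
qed

lemma set_parent_list: "parent_list P \<Longrightarrow> set P \<subseteq> {..<length P}"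
  using parent_less_length by (fastforce simp: in_set_conv_nth)

lemma root_in_parents: "parent_list P \<Longrightarrow> 0 \<in> set P"
  unfolding parent_list_def by (metis length_greater_0_conv nth_mem)

lemma childless_pos: "parent_list P \<Longrightarrow> v \<in> childless P \<Longrightarrow> 0 < v"
  using root_in_parents by (cases v) (auto simp: childless_def)

locale regular_attachment =
  fixes d :: nat
  assumes d: "d \<ge> 3"
begin

lemma set_grow: "set (grow d P v) = insert v (set P)"
  using d by (auto simp: grow_def)

lemma length_grow: "length (grow d P v) = length P + (d - 1)"
  by (simp add: grow_def)

lemma history_length: "history d n P \<Longrightarrow> length P = 2 + (d - 1) * n"
  by (induction rule: history.induct) (use d in \<open>auto simp: length_grow\<close>)

lemma history_card_set: "history d n P \<Longrightarrow> card (set P) = n"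
proof (induction rule: history.induct)
  case history_star
  have *: "set (replicate (Suc d) (0 :: nat)) = {0}" by (rule set_replicate) simp
  show ?case by (subst *) simp
qed (auto simp: set_grow childless_def)

lemma history_card_childless:
  assumes "history d n P"
  shows "card (childless P) = 2 + (d - 2) * n"
proof -
  have "card (childless P) = length P - n"
    unfolding childless_def using set_parent_list[OF history_parent_list[OF assms]] history_card_set[OF assms]
    by (subst card_Diff_subset) auto
  moreover have "d - 1 = Suc (d - 2)" using d by simp
  ultimately show ?thesis using history_length[OF assms] by simp
qed

lemma anc_grow: "parent_list P \<Longrightarrow> w < length P \<Longrightarrow> anc (grow d P v) w = anc P w"
  by (simp add: grow_def anc_append)

lemma anc_grow_new:
  assumes "parent_list P" "v < length P" "length P \<le> w" "w < length (grow d P v)"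
  shows "anc (grow d P v) w = w # anc P v"
proof -
  have 1: "parent_list (grow d P v)" using assms parent_list_append_replicate by (simp add: grow_def)
  have "grow d P v ! w = v" using assms by (simp add: grow_def nth_append)
  moreover have "0 < w" using assms by linarith
  ultimately show ?thesis using anc_pos[OF 1 _ assms(4)] anc_grow[OF assms(1,2)] by simp
qed

lemma parent_grow: "w < length P \<Longrightarrow> grow d P v ! w = P ! w"
  by (simp add: grow_def nth_append)

lemma parent_grow_new: "length P \<le> w \<Longrightarrow> w < length (grow d P v) \<Longrightarrow> grow d P v ! w = v"
  by (simp add: grow_def nth_append)

section \<open>Sizes and leaf counts in terms of internal nodes\<close>

lemma internals_grow:
  assumes P: "parent_list P" and v: "v \<in> childless P"
  shows "internals (grow d P v) w = internals P w + (if w \<in> set (anc P v) then 1 else 0)"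
proof -
  have "{u \<in> set (grow d P v). w \<in> set (anc (grow d P v) u)}
      = (if w \<in> set (anc P v) then insert v {u \<in> set P. w \<in> set (anc P u)} else {u \<in> set P. w \<in> set (anc P u)})"
    using set_parent_list[OF P] v anc_grow[OF P] by (auto simp: set_grow childless_def)
  then show ?thesis using v by (auto simp: internals_def childless_def)
qed

lemma internals_grow_new:
  assumes P: "parent_list P" and v: "v \<in> childless P" and w: "length P \<le> w"
  shows "internals (grow d P v) w = 0"
proof -
  have "w \<notin> set (anc P u)" if "u < length P" for u using anc_bounds[of w P u] that w by auto
  then have "internals P w = 0" "w \<notin> set (anc P v)"
    using set_parent_list[OF P] v by (auto simp: internals_def childless_def)
  then show ?thesis using internals_grow[OF P v] by simp
qed

lemma internals_eq_0_iff:
  assumes P: "parent_list P" and w: "0 < w" "w < length P"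
  shows "internals P w = 0 \<longleftrightarrow> w \<in> childless P"
proof
  show "internals P w = 0 \<Longrightarrow> w \<in> childless P"
    using anc_self[OF P w] w by (auto simp: internals_def childless_def)
  show "internals P w = 0" if "w \<in> childless P"
    using that set_parent_list[OF P] anc_in_parents[OF P] by (fastforce simp: internals_def childless_def)
qed

lemma internals_less:
  assumes "history d n P"
  shows "internals P w < n"
proof -
  have P: "parent_list P" using history_parent_list[OF assms] .
  have "internals P w < card (set P)" unfolding internals_def
  proof (rule psubset_card_mono)
    have "0 \<in> set P - {u \<in> set P. w \<in> set (anc P u)}" using root_in_parents[OF P] by simp
    then show "{u \<in> set P. w \<in> set (anc P u)} \<subset> set P" by blast
  qed simp
  then show ?thesis using history_card_set[OF assms] by simp
qed

text \<open>Attaching at \<open>v\<close> adds \<open>d - 1\<close> nodes and one internal node to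
  each subtree containing \<open>v\<close>. Hence \<open>internals\<close> determines sizes, and by
  \<open>history_card_childless_subtree\<close> also leaf counts, so it is the only statistic that
  the probabilistic part follows.\<close>

lemma history_card_subtree:
  assumes "history d n P" "0 < w" "w < length P"
  shows "card (subtree P w) = 1 + (d - 1) * internals P w"
  using assms
proof (induction arbitrary: w rule: history.induct)
  case history_star
  let ?P = "replicate (Suc d) (0 :: nat)"
  have P: "parent_list ?P" using history_parent_list[OF history.history_star] .
  have "anc ?P u = (if u = 0 then [] else [u])" if "u < length ?P" for u
    using that anc_pos[OF P, of u] by (auto simp del: replicate_Suc)
  then have "u < length ?P \<and> w \<in> set (anc ?P u) \<longleftrightarrow> u = w" for u
    using history_star by (cases "u < length ?P"; cases "u = 0") (auto simp del: replicate_Suc)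
  then have "subtree ?P w = {w}" unfolding subtree_def by (simp del: replicate_Suc length_replicate)
  moreover have "internals ?P w = 0"
  proof -
    have *: "set ?P = {0}" by (rule set_replicate) simp
    have "{u \<in> set ?P. w \<in> set (anc ?P u)} = {}" unfolding * by auto
    then show ?thesis unfolding internals_def by (simp only: card.empty)
  qed
  ultimately show ?case by (simp del: replicate_Suc)
next
  case (history_grow n P v)
  have P: "parent_list P" using history_parent_list[OF history_grow(1)] .
  have vl: "v < length P" using history_grow(2) by (simp add: childless_def)
  let ?new = "{length P..<length P + (d - 1)}"
  show ?case
  proof (cases "w < length P")
    case True
    have "subtree (grow d P v) w = subtree P w \<union> (if w \<in> set (anc P v) then ?new else {})"
    proof (rule set_eqI)
      fix u
      show "u \<in> subtree (grow d P v) w \<longleftrightarrow> u \<in> subtree P w \<union> (if w \<in> set (anc P v) then ?new else {})"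
        using anc_grow[OF P, of u v] anc_grow_new[OF P vl, of u] True
        by (cases "u < length P") (auto simp: subtree_def length_grow)
    qed
    moreover have "subtree P w \<inter> ?new = {}" by (auto simp: subtree_def)
    ultimately have "card (subtree (grow d P v) w) = card (subtree P w) + (if w \<in> set (anc P v) then d - 1 else 0)"
      by (simp add: card_Un_disjoint)
    then show ?thesis using history_grow(3)[OF \<open>0 < w\<close> True] internals_grow[OF P history_grow(2)] by simp
  next
    case False
    have "w \<notin> set (anc P u)" if "u < length P" for u using anc_bounds[of w P u] that False by auto
    then have "u \<in> subtree (grow d P v) w \<longleftrightarrow> u = w" if "u < length (grow d P v)" for u
      using anc_grow[OF P, of u] anc_grow_new[OF P vl, of u] vl that False
      by (cases "u < length P") (auto simp: subtree_def)
    then have "subtree (grow d P v) w = {w}" using history_grow.prems by (auto simp: subtree_def)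
    then show ?thesis using internals_grow_new[OF P history_grow(2)] False by simp
  qed
qed

text \<open>Divided by the number of all leaves, this is the probability that the next attachment
  happens below \<open>w\<close>: the reinforcement rule of the urn.\<close>

lemma history_card_childless_subtree:
  assumes h: "history d n P" and w: "0 < w" "w < length P"
  shows "card {u \<in> childless P. w \<in> set (anc P u)} = 1 + (d - 2) * internals P w"
proof -
  have P: "parent_list P" using history_parent_list[OF h] .
  let ?A = "{u \<in> childless P. w \<in> set (anc P u)}" and ?B = "{u \<in> set P. w \<in> set (anc P u)}"
  have "subtree P w = ?A \<union> ?B" using set_parent_list[OF P] by (auto simp: subtree_def childless_def)
  moreover have "?A \<inter> ?B = {}" by (auto simp: childless_def)
  ultimately have "card (subtree P w) = card ?A + internals P w"
    by (simp add: card_Un_disjoint internals_def)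
  moreover have "d - 1 = Suc (d - 2)" using d by simp
  ultimately show ?thesis using history_card_subtree[OF h w] by simp
qed

lemma history_children:
  assumes "history d n P"
  shows "card {c. 0 < c \<and> c < length P \<and> P ! c = v} \<le> d"
    and "{c. 0 < c \<and> c < length P \<and> P ! c = 0} = {1..d}"
proof -
  \<comment> \<open>The third conjunct strengthens the induction: the chosen leaf has no earlier
    children, so it ends up with exactly \<open>d - 1\<close> of them.\<close>
  have "card {c. 0 < c \<and> c < length P \<and> P ! c = v} \<le> d \<and>
    {c. 0 < c \<and> c < length P \<and> P ! c = 0} = {1..d} \<and>
    (v \<notin> set P \<longrightarrow> {c. 0 < c \<and> c < length P \<and> P ! c = v} = {})" for v
    using assms
  proof (induction arbitrary: v rule: history.induct)
    case history_star
    have *: "{c. 0 < c \<and> c < length (replicate (Suc d) (0::nat)) \<and> replicate (Suc d) 0 ! c = v}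
      = (if v = 0 then {1..d} else {})" for v by (auto simp del: replicate_Suc)
    show ?case unfolding * by (simp del: replicate_Suc)
  next
    case (history_grow n P u)
    have P: "parent_list P" using history_parent_list[OF history_grow(1)] .
    have u: "u < length P" "u \<notin> set P" "0 < u"
      using history_grow(2) childless_pos[OF P] by (auto simp: childless_def)
    have *: "{c. 0 < c \<and> c < length (grow d P u) \<and> grow d P u ! c = v} =
      {c. 0 < c \<and> c < length P \<and> P ! c = v} \<union> (if v = u then {length P..<length P + (d - 1)} else {})" for v
    proof (rule set_eqI)
      fix c
      show "c \<in> {c. 0 < c \<and> c < length (grow d P u) \<and> grow d P u ! c = v} \<longleftrightarrow>
        c \<in> {c. 0 < c \<and> c < length P \<and> P ! c = v} \<union> (if v = u then {length P..<length P + (d - 1)} else {})"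
        using u(1) by (cases "c < length P") (auto simp: parent_grow parent_grow_new length_grow)
    qed
    show ?case
    proof (cases "v = u")
      case True
      have none: "{c. 0 < c \<and> c < length P \<and> P ! c = u} = {}" using history_grow(3)[of u] u by blast
      have "card {c. 0 < c \<and> c < length (grow d P u) \<and> grow d P u ! c = v} \<le> d"
        unfolding * True none by simp
      moreover have "{c. 0 < c \<and> c < length (grow d P u) \<and> grow d P u ! c = 0} = {1..d}"
        unfolding * using history_grow(3)[of 0] u by simp
      ultimately show ?thesis using True by (simp add: set_grow)
    next
      case False
      then show ?thesis using history_grow(3)[of v] u by (simp add: * set_grow)
    qed
  qed
  then show "card {c. 0 < c \<and> c < length P \<and> P ! c = v} \<le> d"
    "{c. 0 < c \<and> c < length P \<and> P ! c = 0} = {1..d}" by blast+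
qed

text \<open>A node other than the root has degree one more than its number of children, and the root
  has degree \<open>d\<close>, which is not 1.\<close>

lemma leaves_graph_of:
  assumes h: "history d n P"
  shows "leaves (graph_of P) = childless P"
proof -
  have P: "parent_list P" using history_parent_list[OF h] .
  have inj: "inj_on (\<lambda>w. {P ! w, w}) {0<..<length P}"
  proof (rule inj_onI)
    fix x y assume "x \<in> {0<..<length P}" "y \<in> {0<..<length P}" and eq: "{P ! x, x} = {P ! y, y}"
    then have "P ! x < x" "P ! y < y" using parent_less[OF P] by auto
    then show "x = y" using eq by (auto simp: doubleton_eq_iff)
  qed
  have deg: "vertex_degree (graph_of P) v = card {w. 0 < w \<and> w < length P \<and> (P ! w = v \<or> w = v)}" for v
  proof -
    let ?W = "{w. 0 < w \<and> w < length P \<and> (P ! w = v \<or> w = v)}"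
    have "{e \<in> edges (graph_of P). v \<in> e} = (\<lambda>w. {P ! w, w}) ` {w \<in> {0<..<length P}. v \<in> {P ! w, w}}"
      unfolding edges_graph_of by blast
    also have "{w \<in> {0<..<length P}. v \<in> {P ! w, w}} = ?W" by auto
    also have "card ((\<lambda>w. {P ! w, w}) ` ?W) = card ?W"
      by (rule card_image, rule inj_on_subset[OF inj]) auto
    finally show ?thesis unfolding vertex_degree_def .
  qed
  have "vertex_degree (graph_of P) v = 1 \<longleftrightarrow> v \<in> childless P" if v: "v < length P" for v
  proof (cases "v = 0")
    case True
    have "{w. 0 < w \<and> w < length P \<and> (P ! w = v \<or> w = v)} = {1..d}"
      unfolding True history_children(2)[OF h, symmetric] by auto
    then show ?thesis using True d root_in_parents[OF P] by (simp add: deg childless_def)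
  next
    case False
    let ?C = "{w. 0 < w \<and> w < length P \<and> P ! w = v}"
    have "v \<notin> ?C" using parent_less[OF P, of v] by auto
    moreover have "{w. 0 < w \<and> w < length P \<and> (P ! w = v \<or> w = v)} = insert v ?C" using False v by auto
    ultimately have "vertex_degree (graph_of P) v = Suc (card ?C)" by (simp add: deg)
    then have "vertex_degree (graph_of P) v = 1 \<longleftrightarrow> ?C = {}" by simp
    also have "\<dots> \<longleftrightarrow> v \<notin> set P"
    proof -
      have "v \<in> set P \<longleftrightarrow> (\<exists>w < length P. P ! w = v)" by (auto simp: in_set_conv_nth)
      moreover have "P ! 0 = 0" using P by (simp add: parent_list_def)
      ultimately have "v \<in> set P \<longleftrightarrow> (\<exists>w. 0 < w \<and> w < length P \<and> P ! w = v)"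
        using False by (metis gr0I)
      then show ?thesis by simp
    qed
    finally show ?thesis using v by (simp add: childless_def)
  qed
  then show ?thesis by (auto simp: leaves_def childless_def graph_of_def)
qed

section \<open>The random process and its expectations\<close>

primrec parent_process :: "nat \<Rightarrow> nat list pmf" where
  "parent_process 0 = return_pmf (replicate (Suc d) 0)"
| "parent_process (Suc m) = bind_pmf (parent_process m) (\<lambda>P. map_pmf (grow d P) (pmf_of_set (childless P)))"

lemma childless_nonempty: "history d n P \<Longrightarrow> childless P \<noteq> {}"
  using history_card_childless by fastforce

lemma set_parent_process: "P \<in> set_pmf (parent_process m) \<Longrightarrow> history d (Suc m) P"
proof (induction m arbitrary: P)
  case 0
  then show ?case using history_star by (simp del: replicate_Suc)
next
  case (Suc m)
  then obtain Q v where Q: "Q \<in> set_pmf (parent_process m)" "v \<in> set_pmf (pmf_of_set (childless Q))" "P = grow d Q v"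
    by auto
  have "history d (Suc m) Q" using Suc.IH[OF Q(1)] .
  moreover from this have "v \<in> childless Q" using Q(2) childless_nonempty by simp
  ultimately show ?case using history_grow Q(3) by blast
qed

lemma graph_of_grow:
  assumes P: "parent_list P" and v: "v < length P"
  shows "attach (d - 1) v (graph_of P) = graph_of (grow d P v)"
proof -
  have "{0<..<length (grow d P v)} = {0<..<length P} \<union> {length P..<length P + (d - 1)}"
    using v by (auto simp: length_grow)
  then have "edges (graph_of (grow d P v)) = (\<lambda>w. {grow d P v ! w, w}) ` {0<..<length P} \<union>
      (\<lambda>w. {grow d P v ! w, w}) ` {length P..<length P + (d - 1)}"
    unfolding edges_graph_of image_Un[symmetric] by simp
  moreover have "(\<lambda>w. {grow d P v ! w, w}) ` {0<..<length P} = edges (graph_of P)"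
    unfolding edges_graph_of by (intro image_cong) (auto simp: parent_grow)
  moreover have "(\<lambda>w. {grow d P v ! w, w}) ` {length P..<length P + (d - 1)} =
      (\<lambda>w. {v, w}) ` {length P..<length P + (d - 1)}"
    by (intro image_cong) (auto simp: parent_grow_new length_grow)
  moreover have "(\<lambda>w. {v, w}) ` {length P..<length P + (d - 1)} = {{v, w} | w. w \<in> {length P..<length P + (d - 1)}}"
    by (rule Setcompr_eq_image[symmetric])
  ultimately have "edges (graph_of (grow d P v)) = edges (graph_of P) \<union> {{v, w} | w. w \<in> {length P..<length P + (d - 1)}}"
    by simp
  then show ?thesis
    by (auto simp: attach_def Let_def graph_of_def length_grow)
qed

lemma UA_parent_process: "UA d (Suc m) = map_pmf graph_of (parent_process m)"
proof (induction m)
  case 0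
  have "edges (graph_of (replicate (Suc d) 0)) = (\<lambda>i. {0, i}) ` {1..d}"
    unfolding edges_graph_of by (intro image_cong) (auto simp del: replicate_Suc)
  then have "star d = graph_of (replicate (Suc d) 0)"
    by (auto simp: star_def graph_of_def root_node_def simp del: replicate_Suc)
  then show ?case by (simp add: UA_def del: replicate_Suc)
next
  case (Suc m)
  have "UA d (Suc (Suc m)) = bind_pmf (UA d (Suc m)) (UA_step d)"
    by (simp add: UA_def)
  also have "\<dots> = bind_pmf (parent_process m) (\<lambda>P. UA_step d (graph_of P))"
    by (simp add: Suc bind_map_pmf)
  also have "\<dots> = bind_pmf (parent_process m) (\<lambda>P. map_pmf graph_of (map_pmf (grow d P) (pmf_of_set (childless P))))"
  proof (intro bind_pmf_cong refl)
    fix P assume "P \<in> set_pmf (parent_process m)"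
    then have h: "history d (Suc m) P" by (rule set_parent_process)
    show "UA_step d (graph_of P) = map_pmf graph_of (map_pmf (grow d P) (pmf_of_set (childless P)))"
      unfolding UA_step_def pmf.map_comp leaves_graph_of[OF h]
      using childless_nonempty[OF h] graph_of_grow[OF history_parent_list[OF h]]
      by (intro map_pmf_cong) (auto simp: childless_def)
  qed
  finally show ?case by (simp add: map_bind_pmf)
qed

lemma finite_parent_process: "finite (set_pmf (parent_process m))"
proof (induction m)
  case (Suc m)
  have "finite (set_pmf (pmf_of_set (childless P)))" if "P \<in> set_pmf (parent_process m)" for P
    using childless_nonempty[OF set_parent_process[OF that]] by simp
  then show ?case using Suc by simp
qed simp

definition expect :: "nat \<Rightarrow> (nat list \<Rightarrow> real) \<Rightarrow> real" where
  "expect m F = measure_pmf.expectation (parent_process m) F"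

lemma expect_0: "expect 0 F = F (replicate (Suc d) 0)"
  by (simp add: expect_def del: replicate_Suc)

lemma integrable_parent_process: "integrable (measure_pmf (parent_process m)) (F :: _ \<Rightarrow> real)"
  by (rule integrable_measure_pmf_finite[OF finite_parent_process])

lemma expect_cong: "(\<And>P. history d (Suc m) P \<Longrightarrow> F P = G P) \<Longrightarrow> expect m F = expect m G"
  unfolding expect_def by (intro integral_cong_AE) (auto simp: AE_measure_pmf_iff dest: set_parent_process)

lemma expect_mono: "(\<And>P. history d (Suc m) P \<Longrightarrow> F P \<le> G P) \<Longrightarrow> expect m F \<le> expect m G"
  unfolding expect_def
  by (intro integral_mono_AE integrable_parent_process) (auto simp: AE_measure_pmf_iff dest: set_parent_process)

lemma
  shows expect_add: "expect m (\<lambda>P. F P + G P) = expect m F + expect m G"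
    and expect_diff: "expect m (\<lambda>P. F P - G P) = expect m F - expect m G"
    and expect_cmult: "expect m (\<lambda>P. c * F P) = c * expect m F"
    and expect_divide: "expect m (\<lambda>P. F P / c) = expect m F / c"
    and expect_const: "expect m (\<lambda>P. c) = c"
  unfolding expect_def by (simp_all add: integrable_parent_process)

lemma expect_Suc:
  "expect (Suc m) F = expect m (\<lambda>P. (\<Sum>v\<in>childless P. F (grow d P v)) / (2 + (real d - 2) * real (Suc m)))"
proof -
  have fin: "finite (set_pmf (map_pmf (grow d P) (pmf_of_set (childless P))))"
    if "P \<in> set_pmf (parent_process m)" for P
    using childless_nonempty[OF set_parent_process[OF that]] by simp
  have "expect (Suc m) F = measure_pmf.expectation (parent_process m)
     (\<lambda>P. measure_pmf.expectation (map_pmf (grow d P) (pmf_of_set (childless P))) F)"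
    unfolding expect_def parent_process.simps
    by (subst pmf_expectation_bind[OF finite_parent_process fin order_refl])
      (auto simp: integral_measure_pmf[OF finite_parent_process])
  also have "\<dots> = expect m (\<lambda>P. (\<Sum>v\<in>childless P. F (grow d P v)) / (2 + (real d - 2) * real (Suc m)))"
    unfolding expect_def[symmetric]
  proof (rule expect_cong)
    fix P assume h: "history d (Suc m) P"
    have "real (d - 2) = real d - 2" using d by simp
    then have "real (card (childless P)) = 2 + (real d - 2) * real (Suc m)"
      unfolding history_card_childless[OF h] by (simp only: of_nat_add of_nat_mult of_nat_numeral)
    then show "measure_pmf.expectation (map_pmf (grow d P) (pmf_of_set (childless P))) F
      = (\<Sum>v\<in>childless P. F (grow d P v)) / (2 + (real d - 2) * real (Suc m))"
      using childless_nonempty[OF h] by (simp add: integral_pmf_of_set)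
  qed
  finally show ?thesis .
qed

end


section \<open>Expected sums over the children of all nodes\<close>

definition nonroots :: "nat list \<Rightarrow> nat set" where
  "nonroots P = {w. 0 < w \<and> w < length P}"

definition sizes :: "nat list \<Rightarrow> nat \<Rightarrow> nat list" where
  "sizes P w = map (internals P) (anc P w)"

lemma finite_nonroots [simp]: "finite (nonroots P)"
  by (simp add: nonroots_def)

context regular_attachment
begin

definition excess :: real where "excess = real d - 2"

lemma excess_ge_1: "excess \<ge> 1" using d by (simp add: excess_def)

lemma real_d_minus_1: "real (d - 1) = 1 + excess"
  using d by (simp add: excess_def)

lemma real_d_minus_2: "real (d - 2) = excess"
  using d by (simp add: excess_def)

text \<open>If \<open>xs = sizes P w\<close>, then \<open>bump L \<phi> xs\<close> is the sum of \<open>\<phi> (sizes P' w)\<close> over the trees \<open>P'\<close>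
  that arise from \<open>P\<close> by attaching to one of its \<open>L\<close> leaves: the sizes that grow form a suffix of
  \<open>xs\<close>, and the number of leaves below the lowest node is \<open>1 + excess * x\<close>.\<close>

primrec bump :: "real \<Rightarrow> (nat list \<Rightarrow> real) \<Rightarrow> nat list \<Rightarrow> real" where
  "bump L \<phi> [] = L * \<phi> []"
| "bump L \<phi> (x # xs) = bump L (\<lambda>ys. \<phi> (x # ys)) xs +
    (1 + excess * real x) * (\<phi> (map Suc (x # xs)) - \<phi> (x # map Suc xs))"

lemma bump_cmult: "bump L (\<lambda>ys. c * \<phi> ys) xs = c * bump L \<phi> xs"
  by (induction xs arbitrary: \<phi>) (simp_all add: algebra_simps)

lemma bump_sum: "bump L (\<lambda>ys. \<Sum>l\<in>A. \<phi> l ys) xs = (\<Sum>l\<in>A. bump L (\<phi> l) xs)"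
  by (induction xs arbitrary: \<phi>)
    (simp_all add: sum_distrib_left sum.distrib sum_subtractf right_diff_distrib)

lemma sizes_grow_below:
  assumes P: "parent_list P" and v: "v \<in> childless P" and w: "w < length P" and sub: "set (anc P w) \<subseteq> set (anc P v)"
  shows "sizes (grow d P v) w = map Suc (sizes P w)"
  using sub by (auto simp: sizes_def anc_grow[OF P w] internals_grow[OF P v])

lemma sizes_grow_new:
  assumes P: "parent_list P" and v: "v \<in> childless P" and w: "length P \<le> w" "w < length (grow d P v)"
  shows "sizes (grow d P v) w = 0 # map Suc (sizes P v)"
proof -
  have vl: "v < length P" using v by (simp add: childless_def)
  have "sizes (grow d P v) w = internals (grow d P v) w # map (internals (grow d P v)) (anc P v)"
    by (simp add: sizes_def anc_grow_new[OF P vl w])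
  moreover have "map (internals (grow d P v)) (anc P v) = sizes (grow d P v) v"
    by (simp add: sizes_def anc_grow[OF P vl])
  ultimately show ?thesis
    using sizes_grow_below[OF P v vl] internals_grow_new[OF P v w(1)] by simp
qed

text \<open>If \<open>v\<close> lies below \<open>w\<close>, all sizes on the path of
  \<open>w\<close> grow; otherwise the size of \<open>w\<close> stays and only the path of its
  parent matters. Writing the first case as the second plus a correction, which occurs for
  \<open>1 + excess * k\<close> leaves \<open>v\<close>, gives the recursion of
  \<open>bump\<close>.\<close>

lemma sum_sizes_grow:
  assumes h: "history d n P" and w: "w < length P"
  shows "(\<Sum>v\<in>childless P. \<phi> (sizes (grow d P v) w)) = bump (2 + excess * real n) \<phi> (sizes P w)"
  using history_parent_list[OF h] w
proof (induction w arbitrary: \<phi> rule: parent_list_induct)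
  case root
  then show ?case using history_card_childless[OF h] by (simp add: sizes_def real_d_minus_2)
next
  case (node w)
  have P: "parent_list P" using history_parent_list[OF h] .
  let ?k = "internals P w" and ?xs = "sizes P (P ! w)"
  let ?c = "\<phi> (Suc ?k # map Suc ?xs) - \<phi> (?k # map Suc ?xs)"
  have pw: "P ! w < length P" using node by simp
  have "\<phi> (sizes (grow d P v) w) = \<phi> (?k # sizes (grow d P v) (P ! w)) + (if w \<in> set (anc P v) then ?c else 0)"
    if v: "v \<in> childless P" for v
  proof -
    have vl: "v < length P" using v by (simp add: childless_def)
    have eq: "sizes (grow d P v) w = internals (grow d P v) w # sizes (grow d P v) (P ! w)"
      using node pw by (simp add: sizes_def anc_grow[OF P])
    show ?thesis
    proof (cases "w \<in> set (anc P v)")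
      case True
      have "set (anc P (P ! w)) \<subseteq> set (anc P v)"
        using anc_subset[OF P vl True] node(4) by simp
      from sizes_grow_below[OF P v pw this] show ?thesis
        using True by (simp add: eq internals_grow[OF P v])
    next
      case False
      then show ?thesis by (simp add: eq internals_grow[OF P v])
    qed
  qed
  then have "(\<Sum>v\<in>childless P. \<phi> (sizes (grow d P v) w)) =
      (\<Sum>v\<in>childless P. \<phi> (?k # sizes (grow d P v) (P ! w))) +
      (\<Sum>v\<in>childless P. if w \<in> set (anc P v) then ?c else 0)"
    by (simp add: sum.distrib)
  also have "(\<Sum>v\<in>childless P. if w \<in> set (anc P v) then ?c else 0) =
      real (card {v \<in> childless P. w \<in> set (anc P v)}) * ?c"
    by (simp add: sum.inter_filter[symmetric])
  also have "real (card {v \<in> childless P. w \<in> set (anc P v)}) = 1 + excess * real ?k"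
    using history_card_childless_subtree[OF h node(1,2)] by (simp add: real_d_minus_2)
  also have "(\<Sum>v\<in>childless P. \<phi> (?k # sizes (grow d P v) (P ! w))) =
      bump (2 + excess * real n) (\<lambda>ys. \<phi> (?k # ys)) ?xs"
    by (rule node(5))
  finally show ?case using node(4) by (simp add: sizes_def)
qed

text \<open>In a subtree with \<open>k\<close> internal nodes, a given child subtree of its top node has \<open>l < k\<close> internal
  nodes with probability \<open>urn_weight l / (\<Sum>j<k. urn_weight j)\<close> (a Polya urn).\<close>

primrec urn_weight :: "nat \<Rightarrow> real" where
  "urn_weight 0 = 1"
| "urn_weight (Suc l) = urn_weight l * (1 + excess * real l) / (excess * real (Suc l))"

lemma urn_weight_pos: "urn_weight l > 0"
  using excess_ge_1 by (induction l) (auto intro!: divide_pos_pos mult_pos_pos add_pos_nonneg)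

lemma urn_weight_Suc: "excess * real (Suc l) * urn_weight (Suc l) = urn_weight l * (1 + excess * real l)"
proof -
  have "excess * real (Suc l) \<noteq> 0" using excess_ge_1 by simp
  then show ?thesis unfolding urn_weight.simps by simp
qed

text \<open>Closed form of the sum of the weights below \<open>k\<close>: it vanishes at 0 and grows
  by \<open>urn_weight k\<close> (\<open>urn_total_add\<close>).\<close>

definition urn_total :: "nat \<Rightarrow> real" where
  "urn_total k = excess * real k * urn_weight k"

lemma urn_total_Suc: "urn_total (Suc k) = urn_weight k * (1 + excess * real k)"
  unfolding urn_total_def by (rule urn_weight_Suc)

lemma urn_total_add: "urn_total (Suc k) = urn_total k + urn_weight k"
  unfolding urn_total_Suc by (simp add: urn_total_def algebra_simps)

lemma urn_total_pos: "k > 0 \<Longrightarrow> urn_total k > 0"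
  using excess_ge_1 urn_weight_pos by (simp add: urn_total_def)

text \<open>The expectation of \<open>\<phi>\<close> summed over the children of a node with sizes \<open>xs\<close>, given \<open>xs\<close>.\<close>

definition offspring :: "(nat list \<Rightarrow> real) \<Rightarrow> nat list \<Rightarrow> real" where
  "offspring \<phi> xs = (1 + excess) / urn_total (hd xs) * (\<Sum>l<hd xs. urn_weight l * \<phi> (l # xs))"

lemma offspring_0: "offspring \<phi> (0 # xs) = 0"
  by (simp add: offspring_def)

text \<open>The balance equation of the urn. Of the \<open>1 + excess * x\<close> leaves below the
  parent, \<open>1 + excess * l\<close> lie below the child and move \<open>l\<close> to
  \<open>Suc l\<close>; the other \<open>excess * (x - l)\<close> keep \<open>l\<close>. By
  \<open>urn_weight_Suc\<close>, the two contributions to each index add up to a multiple of its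
  weight.\<close>

lemma urn_recurrence:
  "(\<Sum>l<x. urn_weight l * (excess * (real x - real l) * \<psi> l + (1 + excess * real l) * \<psi> (Suc l)))
    = excess * real x * (\<Sum>l<Suc x. urn_weight l * \<psi> l)"
proof -
  have "(\<Sum>l<x. urn_weight l * (1 + excess * real l) * \<psi> (Suc l)) =
      (\<Sum>l<x. excess * real (Suc l) * urn_weight (Suc l) * \<psi> (Suc l))"
    by (simp only: urn_weight_Suc)
  also have "\<dots> = (\<Sum>l<Suc x. excess * real l * urn_weight l * \<psi> l)"
    by (subst sum.lessThan_Suc_shift) simp
  finally have 1: "(\<Sum>l<x. urn_weight l * (1 + excess * real l) * \<psi> (Suc l)) = \<dots>" .
  have "(\<Sum>l<x. urn_weight l * (excess * (real x - real l) * \<psi> l)) =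
      (\<Sum>l<Suc x. urn_weight l * (excess * (real x - real l) * \<psi> l))" by simp
  then have "(\<Sum>l<x. urn_weight l * (excess * (real x - real l) * \<psi> l + (1 + excess * real l) * \<psi> (Suc l)))
      = (\<Sum>l<Suc x. urn_weight l * (excess * (real x - real l) * \<psi> l)) + (\<Sum>l<Suc x. excess * real l * urn_weight l * \<psi> l)"
    unfolding 1[symmetric] by (simp add: sum.distrib[symmetric] algebra_simps)
  also have "\<dots> = (\<Sum>l<Suc x. excess * real x * (urn_weight l * \<psi> l))"
    unfolding sum.distrib[symmetric] by (intro sum.cong refl) (simp add: algebra_simps)
  finally show ?thesis by (simp only: sum_distrib_left)
qed

text \<open>Averaging over the children commutes with an attachment step because
  \<open>urn_recurrence\<close> preserves the urn law. The exception is a leaf: when chosen, it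
  acquires \<open>1 + excess\<close> children of size 0, which is the extra term.\<close>

lemma bump_offspring:
  "bump L (offspring \<phi>) (x # xs) = offspring (bump L \<phi>) (x # xs) +
    (if x = 0 then (1 + excess) * \<phi> (0 # map Suc (x # xs)) else 0)"
proof -
  define \<psi> where "\<psi> l = \<phi> (l # map Suc (x # xs))" for l
  define c where "c = (1 + excess) / urn_total x"
  let ?lf = "\<lambda>l. 1 + excess * real l"
  define U where "U = (\<Sum>l<x. urn_weight l * bump L (\<lambda>ys. \<phi> (l # x # ys)) xs)"
  define V where "V = (\<Sum>l<x. urn_weight l * \<phi> (l # x # map Suc xs))"
  have "(\<lambda>ys. offspring \<phi> (x # ys)) = (\<lambda>ys. c * (\<Sum>l<x. urn_weight l * \<phi> (l # x # ys)))"
    by (simp add: offspring_def c_def fun_eq_iff)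
  then have 1: "bump L (\<lambda>ys. offspring \<phi> (x # ys)) xs = c * U"
    by (simp add: bump_cmult bump_sum U_def)
  have 2: "?lf x * offspring \<phi> (map Suc (x # xs)) = (1 + excess) / urn_weight x * (\<Sum>l<Suc x. urn_weight l * \<psi> l)"
  proof -
    have "?lf x \<noteq> 0" using excess_ge_1 by (smt (verit) mult_nonneg_nonneg of_nat_0_le_iff)
    then show ?thesis by (simp add: offspring_def \<psi>_def urn_total_Suc del: sum.lessThan_Suc)
  qed
  have 3: "offspring \<phi> (x # map Suc xs) = c * V"
    by (simp add: offspring_def c_def V_def)
  have "offspring (bump L \<phi>) (x # xs) = c * (\<Sum>l<x. urn_weight l * bump L \<phi> (l # x # xs))"
    by (simp add: offspring_def c_def)
  also have "(\<Sum>l<x. urn_weight l * bump L \<phi> (l # x # xs)) = (\<Sum>l<x. urn_weight l * bump L (\<lambda>ys. \<phi> (l # x # ys)) xs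
      + urn_weight l * (excess * (real x - real l) * \<psi> l + ?lf l * \<psi> (Suc l)) - ?lf x * (urn_weight l * \<phi> (l # x # map Suc xs)))"
    by (intro sum.cong refl) (simp add: \<psi>_def algebra_simps)
  also have "\<dots> = U + excess * real x * (\<Sum>l<Suc x. urn_weight l * \<psi> l) - ?lf x * V"
    unfolding sum_subtractf sum.distrib urn_recurrence U_def V_def by (simp only: sum_distrib_left)
  finally have 4: "offspring (bump L \<phi>) (x # xs) =
      c * (U + excess * real x * (\<Sum>l<Suc x. urn_weight l * \<psi> l) - ?lf x * V)" .
  \<comment> \<open>For \<open>x = 0\<close> the urn term vanishes and the extra term supplies the
    whole right-hand side.\<close>
  have 5: "c * (excess * real x) * (\<Sum>l<Suc x. urn_weight l * \<psi> l) + (if x = 0 then (1 + excess) * \<psi> 0 else 0)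
      = (1 + excess) / urn_weight x * (\<Sum>l<Suc x. urn_weight l * \<psi> l)"
  proof (cases "x = 0")
    case False
    then have "c * (excess * real x) = (1 + excess) / urn_weight x"
      using excess_ge_1 by (simp add: c_def urn_total_def)
    then show ?thesis using False by simp
  qed simp
  have "bump L (offspring \<phi>) (x # xs) = c * U + (?lf x * offspring \<phi> (map Suc (x # xs)) - ?lf x * (c * V))"
    unfolding bump.simps 1 3 by (simp only: right_diff_distrib)
  also have "\<dots> = c * U + ((c * (excess * real x) * (\<Sum>l<Suc x. urn_weight l * \<psi> l) + (if x = 0 then (1 + excess) * \<psi> 0 else 0)) - ?lf x * (c * V))"
    unfolding 2 5 ..
  also have "\<dots> = offspring (bump L \<phi>) (x # xs) + (if x = 0 then (1 + excess) * \<psi> 0 else 0)"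
    unfolding 4 by (simp only: right_diff_distrib distrib_left mult.assoc mult.left_commute add.assoc diff_conv_add_uminus mult_minus_right ac_simps)
  finally show ?thesis by (simp only: \<psi>_def)
qed

text \<open>These are the nodes whose parent is itself in \<open>nonroots\<close>, so the ones that
  \<open>offspring\<close> accounts for.\<close>

definition deep :: "nat list \<Rightarrow> nat set" where
  "deep P = {w \<in> nonroots P. P ! w \<noteq> 0}"

lemma finite_deep [simp]: "finite (deep P)"
  by (simp add: deep_def)

lemma
  assumes P: "parent_list P" and v: "v \<in> childless P"
  shows sum_nonroots_grow: "(\<Sum>w\<in>nonroots (grow d P v). F (sizes (grow d P v) w)) =
      (\<Sum>w\<in>nonroots P. F (sizes (grow d P v) w)) + (1 + excess) * F (0 # map Suc (sizes P v))" (is ?A)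
    and sum_deep_grow: "(\<Sum>w\<in>deep (grow d P v). F (sizes (grow d P v) w)) =
      (\<Sum>w\<in>deep P. F (sizes (grow d P v) w)) + (1 + excess) * F (0 # map Suc (sizes P v))" (is ?B)
proof -
  let ?new = "{length P..<length P + (d - 1)}"
  have v0: "0 < v" "v < length P" using childless_pos[OF P v] v by (auto simp: childless_def)
  have "(\<Sum>w\<in>?new. F (sizes (grow d P v) w)) = (\<Sum>w\<in>?new. F (0 # map Suc (sizes P v)))"
    using sizes_grow_new[OF P v] by (intro sum.cong refl) (simp add: length_grow)
  then have new: "(\<Sum>w\<in>?new. F (sizes (grow d P v) w)) = (1 + excess) * F (0 # map Suc (sizes P v))"
    by (simp add: real_d_minus_1[symmetric])
  have "nonroots (grow d P v) = nonroots P \<union> ?new" "nonroots P \<inter> ?new = {}"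
    using v0 by (auto simp: nonroots_def length_grow)
  then show ?A using new by (simp add: sum.union_disjoint)
  have "w \<in> deep (grow d P v) \<longleftrightarrow> w \<in> deep P \<union> ?new" for w
    using v0 by (cases "w < length P") (auto simp: deep_def nonroots_def length_grow parent_grow parent_grow_new)
  moreover have "deep P \<inter> ?new = {}" by (auto simp: deep_def nonroots_def)
  ultimately have "deep (grow d P v) = deep P \<union> ?new" "deep P \<inter> ?new = {}" by blast+
  then show ?B using new by (simp add: sum.union_disjoint)
qed

text \<open>Both sides obey the same recursion in time: \<open>bump_offspring\<close> moves the
  attachment step past \<open>offspring\<close>, and the induction hypothesis is applied to the
  bumped test function, whence the generality in \<open>\<phi>\<close>. New nodes enter on the left
  as summands and on the right through the leaf that becomes their parent.\<close>

theorem expect_offspring: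
  "expect m (\<lambda>P. \<Sum>w\<in>deep P. \<phi> (sizes P w)) = expect m (\<lambda>P. \<Sum>w\<in>nonroots P. offspring \<phi> (sizes P w))"
proof (induction m arbitrary: \<phi>)
  case 0
  let ?P = "replicate (Suc d) (0 :: nat)"
  have P: "parent_list ?P" using history_parent_list[OF history.history_star] .
  have "deep ?P = {}" by (auto simp: deep_def nonroots_def simp del: replicate_Suc)
  moreover have "offspring \<phi> (sizes ?P w) = 0" if "w \<in> nonroots ?P" for w
  proof -
    have w: "0 < w" "w < length ?P" using that by (auto simp: nonroots_def)
    then have "w \<in> childless ?P" by (auto simp: childless_def simp del: replicate_Suc)
    then have "internals ?P w = 0" using internals_eq_0_iff[OF P w] by blast
    moreover have "anc ?P w = [w]" using anc_pos[OF P w] w by (simp del: replicate_Suc)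
    ultimately show ?thesis by (simp add: sizes_def offspring_0 del: replicate_Suc)
  qed
  ultimately show ?case by (simp add: expect_0 del: replicate_Suc)
next
  case (Suc m)
  define L where "L = 2 + excess * real (Suc m)"
  define Z where "Z P = (1 + excess) * (\<Sum>v\<in>childless P. \<phi> (0 # map Suc (sizes P v)))" for P
  have "expect (Suc m) (\<lambda>P. \<Sum>w\<in>deep P. \<phi> (sizes P w)) =
      expect m (\<lambda>P. ((\<Sum>w\<in>deep P. bump L \<phi> (sizes P w)) + Z P) / L)"
    unfolding expect_Suc excess_def[symmetric] L_def[symmetric]
  proof (rule expect_cong)
    fix P assume h: "history d (Suc m) P"
    have P: "parent_list P" using history_parent_list[OF h] .
    have "(\<Sum>v\<in>childless P. \<Sum>w\<in>deep (grow d P v). \<phi> (sizes (grow d P v) w)) =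
        (\<Sum>v\<in>childless P. (\<Sum>w\<in>deep P. \<phi> (sizes (grow d P v) w)) + (1 + excess) * \<phi> (0 # map Suc (sizes P v)))"
      using sum_deep_grow[OF P] by (intro sum.cong refl) simp
    also have "\<dots> = (\<Sum>w\<in>deep P. \<Sum>v\<in>childless P. \<phi> (sizes (grow d P v) w)) + Z P"
      by (simp add: sum.distrib Z_def sum_distrib_left sum.swap[of _ "deep P"])
    also have "(\<Sum>w\<in>deep P. \<Sum>v\<in>childless P. \<phi> (sizes (grow d P v) w)) = (\<Sum>w\<in>deep P. bump L \<phi> (sizes P w))"
      using sum_sizes_grow[OF h] by (intro sum.cong refl) (auto simp: deep_def nonroots_def L_def)
    finally show "(\<Sum>v\<in>childless P. \<Sum>w\<in>deep (grow d P v). \<phi> (sizes (grow d P v) w)) / L =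
        ((\<Sum>w\<in>deep P. bump L \<phi> (sizes P w)) + Z P) / L" by simp
  qed
  also have "\<dots> = (expect m (\<lambda>P. \<Sum>w\<in>deep P. bump L \<phi> (sizes P w)) + expect m Z) / L"
    by (simp add: expect_add expect_divide)
  also have "\<dots> = (expect m (\<lambda>P. \<Sum>w\<in>nonroots P. offspring (bump L \<phi>) (sizes P w)) + expect m Z) / L"
    unfolding Suc.IH ..
  also have "\<dots> = expect m (\<lambda>P. ((\<Sum>w\<in>nonroots P. offspring (bump L \<phi>) (sizes P w)) + Z P) / L)"
    by (simp add: expect_add expect_divide)
  also have "\<dots> = expect (Suc m) (\<lambda>P. \<Sum>w\<in>nonroots P. offspring \<phi> (sizes P w))"
    unfolding expect_Suc excess_def[symmetric] L_def[symmetric]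
  proof (rule expect_cong)
    fix P assume h: "history d (Suc m) P"
    have P: "parent_list P" using history_parent_list[OF h] .
    have "(\<Sum>v\<in>childless P. \<Sum>w\<in>nonroots (grow d P v). offspring \<phi> (sizes (grow d P v) w)) =
        (\<Sum>v\<in>childless P. \<Sum>w\<in>nonroots P. offspring \<phi> (sizes (grow d P v) w))"
      by (rule sum.cong[OF refl]) (simp add: sum_nonroots_grow[OF P] offspring_0)
    also have "\<dots> = (\<Sum>w\<in>nonroots P. \<Sum>v\<in>childless P. offspring \<phi> (sizes (grow d P v) w))"
      by (rule sum.swap)
    also have "\<dots> = (\<Sum>w\<in>nonroots P. bump L (offspring \<phi>) (sizes P w))"
      using sum_sizes_grow[OF h] by (intro sum.cong refl) (auto simp: nonroots_def L_def)
    also have "\<dots> = (\<Sum>w\<in>nonroots P. offspring (bump L \<phi>) (sizes P w) +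
        (if w \<in> childless P then (1 + excess) * \<phi> (0 # map Suc (sizes P w)) else 0))"
    proof (intro sum.cong refl)
      fix w assume "w \<in> nonroots P"
      then have w: "0 < w" "w < length P" by (auto simp: nonroots_def)
      have "sizes P w = internals P w # sizes P (P ! w)" using anc_pos[OF P w] by (simp add: sizes_def)
      then show "bump L (offspring \<phi>) (sizes P w) = offspring (bump L \<phi>) (sizes P w) +
          (if w \<in> childless P then (1 + excess) * \<phi> (0 # map Suc (sizes P w)) else 0)"
        unfolding internals_eq_0_iff[OF P w, symmetric] by (simp only: bump_offspring)
    qed
    also have "\<dots> = (\<Sum>w\<in>nonroots P. offspring (bump L \<phi>) (sizes P w)) + Z P"
    proof -
      have "nonroots P \<inter> childless P = childless P"
        using childless_pos[OF P] by (auto simp: nonroots_def childless_def)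
      then show ?thesis
        by (simp add: sum.distrib Z_def sum_distrib_left sum.inter_restrict[symmetric])
    qed
    finally show "((\<Sum>w\<in>nonroots P. offspring (bump L \<phi>) (sizes P w)) + Z P) / L =
        (\<Sum>v\<in>childless P. \<Sum>w\<in>nonroots (grow d P v). offspring \<phi> (sizes (grow d P v) w)) / L" by simp
  qed
  finally show ?case .
qed

end


section \<open>A moment bound\<close>

lemma sum_inverse_sqrt_le: "(\<Sum>l<n. 1 / sqrt (real (Suc l))) \<le> 2 * sqrt (real n)"
proof (induction n)
  case (Suc n)
  let ?a = "sqrt (real n)" and ?b = "sqrt (real (Suc n))"
  have b: "?b > 0" "?a \<le> ?b" by simp_all
  have "(?b - ?a) * (?b + ?a) = 1" by (simp add: algebra_simps flip: power2_eq_square)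
  moreover have "(?b - ?a) * (?b + ?a) \<le> (?b - ?a) * (2 * ?b)" using b by (intro mult_left_mono) auto
  ultimately have "1 / ?b \<le> 2 * ?b - 2 * ?a" using b by (simp add: field_simps)
  then show ?case using Suc by simp
qed simp

lemma inverse_sqrt_mult_le:
  fixes a b :: real
  assumes "a > 0" "b > 0"
  shows "1 / sqrt (a * b) \<le> (1 / sqrt a + 1 / sqrt b) / sqrt (a + b)"
proof -
  have "1 / a + 1 / b = (a + b) * (1 / (a * b))" using assms by (simp add: field_simps)
  then have "1 / (a * b) = (1 / a + 1 / b) / (a + b)" using assms by simp
  then have "1 / sqrt (a * b) = sqrt (1 / a + 1 / b) / sqrt (a + b)"
    by (metis real_sqrt_divide real_sqrt_one)
  also have "\<dots> \<le> (sqrt (1 / a) + sqrt (1 / b)) / sqrt (a + b)"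
    using assms by (intro divide_right_mono sqrt_add_le_add_sqrt) auto
  finally show ?thesis by (simp add: real_sqrt_divide)
qed

text \<open>A discrete form of the integral of \<open>1 / sqrt (x * (1 - x))\<close> over the unit
  interval, which converges at both ends. \<open>inverse_sqrt_mult_le\<close> acts as a partial
  fraction decomposition and separates the two singularities.\<close>

lemma sum_inverse_sqrt_mult_le: "(\<Sum>l<n. 1 / sqrt (real (Suc l) * real (n - l))) \<le> 4"
proof -
  have "(\<Sum>l<n. 1 / sqrt (real (Suc l) * real (n - l))) \<le>
      (\<Sum>l<n. (1 / sqrt (real (Suc l)) + 1 / sqrt (real (n - l))) / sqrt (real (Suc n)))"
  proof (rule sum_mono)
    fix l assume "l \<in> {..<n}"
    then have l: "l < n" by simp
    then have "real (Suc l) + real (n - l) = real (Suc n)" by simp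
    then show "1 / sqrt (real (Suc l) * real (n - l)) \<le>
        (1 / sqrt (real (Suc l)) + 1 / sqrt (real (n - l))) / sqrt (real (Suc n))"
      using inverse_sqrt_mult_le[of "real (Suc l)" "real (n - l)"] l by simp
  qed
  also have "\<dots> = ((\<Sum>l<n. 1 / sqrt (real (Suc l))) + (\<Sum>l<n. 1 / sqrt (real (n - l)))) / sqrt (real (Suc n))"
    by (simp only: sum.distrib sum_divide_distrib[symmetric])
  also have "(\<Sum>l<n. 1 / sqrt (real (n - l))) = (\<Sum>l<n. 1 / sqrt (real (Suc l)))"
    using sum.nat_diff_reindex[of "\<lambda>l. 1 / sqrt (real (Suc l))" n]
    by (simp add: Suc_diff_Suc cong: sum.cong_simp)
  also have "(\<dots> + \<dots>) / sqrt (real (Suc n)) \<le> (2 * sqrt (real n) + 2 * sqrt (real n)) / sqrt (real (Suc n))"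
    by (intro divide_right_mono add_mono sum_inverse_sqrt_le) simp
  also have "\<dots> \<le> (4 * sqrt (real (Suc n))) / sqrt (real (Suc n))"
    by (intro divide_right_mono) auto
  also have "\<dots> = 4" by simp
  finally show ?thesis .
qed

context regular_attachment
begin

text \<open>The sum over all descendants \<open>v\<close> of a node with \<open>k\<close> internal nodes below it of the products of
  \<open>2 * g\<close> along the paths to \<open>v\<close> has an expectation \<open>f k\<close> with
  \<open>urn_total k * (f k - 1) = 2 * (1 + excess) * (\<Sum>l<k. urn_weight l * g l * f l)\<close>;
  \<open>growth g\<close> bounds the solution of this recursion.\<close>

definition growth :: "(nat \<Rightarrow> real) \<Rightarrow> nat \<Rightarrow> real" where
  "growth g k = (\<Prod>l<k. 1 + 2 * (1 + excess) * g l / (1 + excess * real l))"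

lemma growth_ge_1:
  assumes "\<And>l. g l \<ge> 0"
  shows "growth g k \<ge> 1"
  unfolding growth_def using excess_ge_1 assms by (intro prod_ge_1) (auto intro!: divide_nonneg_nonneg)

text \<open>The factors of \<open>growth\<close> are chosen so that, from \<open>k\<close> to
  \<open>Suc k\<close>, its increment yields exactly the new summand; the surplus
  \<open>urn_weight k * (growth g k - 1)\<close> is nonnegative and is dropped.\<close>

lemma growth_supersolution:
  assumes g: "\<And>l. g l \<ge> 0"
  shows "2 * (1 + excess) * (\<Sum>l<k. urn_weight l * (g l * growth g l)) \<le> urn_total k * (growth g k - 1)"
proof (induction k)
  case 0
  then show ?case by (simp add: urn_total_def)
next
  case (Suc k)
  let ?F = "growth g k" and ?a = "2 * (1 + excess) * g k"
  have nz: "1 + excess * real k > 0" using excess_ge_1 by (intro add_pos_nonneg) auto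
  have "growth g (Suc k) - 1 = (?F - 1) + ?F * (?a / (1 + excess * real k))"
    by (simp add: growth_def algebra_simps)
  then have "urn_total (Suc k) * (growth g (Suc k) - 1) =
      urn_total (Suc k) * (?F - 1) + urn_total (Suc k) * (?F * (?a / (1 + excess * real k)))"
    by (simp only: distrib_left)
  also have "urn_total (Suc k) * (?F * (?a / (1 + excess * real k))) = urn_weight k * (?F * ?a)"
    unfolding urn_total_Suc using nz by simp
  also have "urn_total (Suc k) * (?F - 1) = urn_total k * (?F - 1) + urn_weight k * (?F - 1)"
    by (simp add: urn_total_add algebra_simps)
  also have "urn_total k * (?F - 1) + urn_weight k * (?F - 1) + urn_weight k * (?F * ?a) \<ge>
      urn_total k * (?F - 1) + urn_weight k * (?F * ?a)"
    using growth_ge_1[of g k, OF g] urn_weight_pos[of k] by simp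
  finally show ?case using Suc by (simp add: algebra_simps)
qed

text \<open>Passing from a node to its children lowers the potential, product times
  \<open>growth\<close>, by at least the product at the node. These decreases pay for all the
  products in the tree.\<close>

lemma offspring_prod_le:
  assumes g: "\<And>l. g l \<ge> 0"
  shows "offspring (\<lambda>xs. (\<Prod>x\<leftarrow>xs. 2 * g x) * growth g (hd xs)) (x # xs) \<le>
    (\<Prod>x\<leftarrow>x # xs. 2 * g x) * growth g x - (\<Prod>x\<leftarrow>x # xs. 2 * g x)"
proof (cases "x = 0")
  case True
  then show ?thesis by (simp add: offspring_0 growth_def)
next
  case False
  let ?p = "\<Prod>x\<leftarrow>x # xs. 2 * g x"
  have p: "?p \<ge> 0" using g by (intro prod_list_nonneg) auto
  have pos: "urn_total x > 0" using False urn_total_pos by simp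
  have "offspring (\<lambda>xs. (\<Prod>x\<leftarrow>xs. 2 * g x) * growth g (hd xs)) (x # xs) =
      (1 + excess) / urn_total x * (\<Sum>l<x. 2 * ?p * (urn_weight l * (g l * growth g l)))"
    by (simp add: offspring_def algebra_simps)
  also have "\<dots> = ?p * (2 * (1 + excess) * (\<Sum>l<x. urn_weight l * (g l * growth g l)) / urn_total x)"
    unfolding sum_distrib_left[symmetric] by simp
  also have "\<dots> \<le> ?p * (growth g x - 1)"
    using growth_supersolution[of g x, OF g] pos p by (intro mult_left_mono) (simp_all add: field_simps)
  finally show ?thesis by (simp add: algebra_simps)
qed

lemma history_root_child:
  assumes h: "history d n P" and w: "w \<in> {1..d}"
  shows "0 < w" "w < length P" "anc P w = [w]" "sizes P w = [internals P w]"
proof -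
  have "w \<in> {c. 0 < c \<and> c < length P \<and> P ! c = 0}" using history_children(2)[OF h] w by simp
  then show 1: "0 < w" "w < length P" and "anc P w = [w]"
    using anc_pos[OF history_parent_list[OF h]] by auto
  then show "sizes P w = [internals P w]" by (simp add: sizes_def)
qed

text \<open>After \<open>expect_offspring\<close>, the potentials of the \<open>deep\<close> nodes
  occur on both sides of the summed inequality and cancel; those of the children of the root
  remain.\<close>

theorem expect_prod_sizes_le:
  assumes g: "\<And>l. g l \<ge> 0"
  shows "expect m (\<lambda>P. \<Sum>w\<in>nonroots P. \<Prod>x\<leftarrow>sizes P w. 2 * g x) \<le>
    expect m (\<lambda>P. \<Sum>w=1..d. 2 * g (internals P w) * growth g (internals P w))"
proof -
  define \<phi> where "\<phi> xs = (\<Prod>x\<leftarrow>xs. 2 * g x) * growth g (hd xs)" for xs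
  let ?p = "\<lambda>P w. \<Prod>x\<leftarrow>sizes P w. 2 * g x"
  have "expect m (\<lambda>P. \<Sum>w\<in>deep P. \<phi> (sizes P w)) = expect m (\<lambda>P. \<Sum>w\<in>nonroots P. offspring \<phi> (sizes P w))"
    by (rule expect_offspring)
  also have "\<dots> \<le> expect m (\<lambda>P. (\<Sum>w\<in>deep P. \<phi> (sizes P w)) +
      (\<Sum>w=1..d. 2 * g (internals P w) * growth g (internals P w)) - (\<Sum>w\<in>nonroots P. ?p P w))"
  proof (rule expect_mono)
    fix P assume h: "history d (Suc m) P"
    have P: "parent_list P" using history_parent_list[OF h] .
    have "(\<Sum>w\<in>nonroots P. offspring \<phi> (sizes P w)) \<le> (\<Sum>w\<in>nonroots P. \<phi> (sizes P w) - ?p P w)"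
    proof (rule sum_mono)
      fix w assume "w \<in> nonroots P"
      then have "sizes P w = internals P w # sizes P (P ! w)"
        using anc_pos[OF P] by (simp add: sizes_def nonroots_def)
      then show "offspring \<phi> (sizes P w) \<le> \<phi> (sizes P w) - ?p P w"
        using offspring_prod_le[of g "internals P w" "sizes P (P ! w)", OF g] by (simp add: \<phi>_def[abs_def])
    qed
    also have "\<dots> = (\<Sum>w\<in>nonroots P. \<phi> (sizes P w)) - (\<Sum>w\<in>nonroots P. ?p P w)"
      by (rule sum_subtractf)
    also have "(\<Sum>w\<in>nonroots P. \<phi> (sizes P w)) = (\<Sum>w\<in>deep P. \<phi> (sizes P w)) + (\<Sum>w\<in>nonroots P - deep P. \<phi> (sizes P w))"
      by (rule sum.subset_diff[THEN trans[OF _ add.commute]]) (auto simp: deep_def)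
    also have "nonroots P - deep P = {1..d}"
      unfolding history_children(2)[OF h, symmetric] by (auto simp: nonroots_def deep_def)
    also have "(\<Sum>w=1..d. \<phi> (sizes P w)) = (\<Sum>w=1..d. 2 * g (internals P w) * growth g (internals P w))"
      by (intro sum.cong refl) (simp add: history_root_child[OF h] \<phi>_def)
    finally show "(\<Sum>w\<in>nonroots P. offspring \<phi> (sizes P w)) \<le> (\<Sum>w\<in>deep P. \<phi> (sizes P w)) +
      (\<Sum>w=1..d. 2 * g (internals P w) * growth g (internals P w)) - (\<Sum>w\<in>nonroots P. ?p P w)" .
  qed
  finally show ?thesis by (simp add: expect_add expect_diff)
qed

text \<open>Controls the odds of a dominating child of the root, whose denominator is small. If
  \<open>B\<close> leaves out of \<open>L\<close> lie outside the child,
  \<open>1 / (B - excess)\<close> is an eigenfunction of the attachment step: its mean is multiplied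
  by \<open>(L - excess) / L\<close>, and these factors telescope.\<close>

lemma expect_root_children:
  "expect m (\<lambda>P. \<Sum>w=1..d. 1 / (1 + excess * (real m - real (internals P w)))) = 2 * real d / (2 + excess * real m)"
proof (induction m)
  case 0
  let ?P = "replicate (Suc d) (0 :: nat)"
  have h: "history d 1 ?P" by (rule history.history_star)
  have "internals ?P w = 0" for w using internals_less[OF h] by simp
  then show ?case by (simp add: expect_0 del: replicate_Suc)
next
  case (Suc m)
  define L where "L = 2 + excess * real (Suc m)"
  have L: "L > 0" "L - excess > 0" using excess_ge_1 by (auto simp: L_def algebra_simps intro!: add_pos_nonneg)
  let ?h = "\<lambda>m P w. 1 / (1 + excess * (real m - real (internals P w)))"
  have "expect (Suc m) (\<lambda>P. \<Sum>w=1..d. ?h (Suc m) P w) = expect m (\<lambda>P. (L - excess) / L * (\<Sum>w=1..d. ?h m P w))"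
    unfolding expect_Suc excess_def[symmetric] L_def[symmetric]
  proof (rule expect_cong)
    fix P assume h: "history d (Suc m) P"
    have P: "parent_list P" using history_parent_list[OF h] .
    have "(\<Sum>v\<in>childless P. \<Sum>w=1..d. ?h (Suc m) (grow d P v) w) = (\<Sum>w=1..d. \<Sum>v\<in>childless P. ?h (Suc m) (grow d P v) w)"
      by (rule sum.swap)
    also have "\<dots> = (\<Sum>w=1..d. (L - excess) * ?h m P w)"
    proof (rule sum.cong[OF refl])
      fix w assume w: "w \<in> {1..d}"
      define \<phi> where "\<phi> xs = 1 / (1 + excess * (real (Suc m) - real (hd xs)))" for xs :: "nat list"
      let ?k = "real (internals P w)"
      define y where "y = 1 + excess * (real m - ?k)"
      have "internals P w \<le> m" using internals_less[OF h] by (simp add: less_Suc_eq_le)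
      then have y: "y > 0" unfolding y_def using excess_ge_1 by (intro add_pos_nonneg mult_nonneg_nonneg) auto
      have "?h (Suc m) (grow d P v) w = \<phi> (sizes (grow d P v) w)" for v
        using history_root_child[OF h w] by (simp add: \<phi>_def sizes_def anc_grow[OF P])
      then have "(\<Sum>v\<in>childless P. ?h (Suc m) (grow d P v) w) = bump L \<phi> [internals P w]"
        using sum_sizes_grow[OF h, of w \<phi>] history_root_child[OF h w] by (simp add: L_def)
      also have "\<dots> = L / (y + excess) + (1 + excess * ?k) * (1 / y - 1 / (y + excess))"
        by (simp add: \<phi>_def y_def algebra_simps)
      also have "1 + excess * ?k = L - (y + excess)" by (simp add: L_def y_def algebra_simps)
      also have "L / (y + excess) + (L - (y + excess)) * (1 / y - 1 / (y + excess)) = (L - excess) * (1 / y)"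
        using y excess_ge_1 by (simp add: divide_simps) (simp add: algebra_simps)
      finally show "(\<Sum>v\<in>childless P. ?h (Suc m) (grow d P v) w) = (L - excess) * ?h m P w" by (simp add: y_def)
    qed
    also have "\<dots> = (L - excess) * (\<Sum>w=1..d. ?h m P w)"
      by (rule sum_distrib_left[symmetric])
    finally show "(\<Sum>v\<in>childless P. \<Sum>w=1..d. ?h (Suc m) (grow d P v) w) / L = (L - excess) / L * (\<Sum>w=1..d. ?h m P w)"
      by simp
  qed
  also have "\<dots> = (L - excess) / L * (2 * real d / (L - excess))"
    unfolding expect_cmult Suc by (simp add: L_def algebra_simps)
  also have "\<dots> = 2 * real d / L" using L by simp
  finally show ?case by (simp only: L_def)
qed

text \<open>The quotient \<open>s / (N - s)\<close> at time \<open>n\<close> for a subtree with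
  \<open>k\<close> internal nodes, since \<open>1 + excess = d - 1\<close>; see
  \<open>history_odds\<close>.\<close>

definition odds :: "nat \<Rightarrow> nat \<Rightarrow> real" where
  "odds n k = (1 + (1 + excess) * real k) / (1 + (1 + excess) * real (n - k))"

lemma odds_pos: "odds n k > 0"
  unfolding odds_def using excess_ge_1 by (intro divide_pos_pos add_pos_nonneg) auto

lemma growth_odds_le:
  assumes "k \<le> n"
  shows "growth (\<lambda>l. sqrt (odds n l)) k \<le> exp (16 * (1 + excess))"
proof -
  let ?t = "\<lambda>l. sqrt (odds n l) / (1 + excess * real l)"
  have lf: "1 + excess * real l > 0" for l using excess_ge_1 by (intro add_pos_nonneg) auto
  have t0: "?t l \<ge> 0" for l using odds_pos[of n l] lf[of l] by simp
  have t: "?t l \<le> 2 * (1 / sqrt (real (Suc l) * real (n - l)))" if l: "l < n" for l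
  proof -
    have a: "1 + (1 + excess) * real l \<le> 2 * (1 + excess * real l)"
      using excess_ge_1 mult_right_mono[of 1 excess "real l"] by (simp add: algebra_simps)
    have b: "real (Suc l) \<le> 1 + excess * real l"
      using excess_ge_1 mult_right_mono[of 1 excess "real l"] by (simp add: algebra_simps)
    have c: "real (n - l) \<le> 1 + (1 + excess) * real (n - l)"
      using excess_ge_1 by (simp add: algebra_simps)
    have "odds n l / (1 + excess * real l)\<^sup>2 =
        (1 + (1 + excess) * real l) / ((1 + (1 + excess) * real (n - l)) * (1 + excess * real l)\<^sup>2)"
      by (simp add: odds_def)
    also have "\<dots> \<le> 2 * (1 + excess * real l) / ((1 + (1 + excess) * real (n - l)) * (1 + excess * real l)\<^sup>2)"
      using a c l lf[of l] by (intro divide_right_mono) auto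
    also have "\<dots> = 2 / ((1 + (1 + excess) * real (n - l)) * (1 + excess * real l))"
    proof -
      have "2 * a / (b * a\<^sup>2) = 2 / (b * a)" if "a > 0" for a b :: real
        using that by (simp add: power2_eq_square)
      then show ?thesis using lf[of l] by blast
    qed
    also have "\<dots> \<le> 2 / (real (n - l) * real (Suc l))"
      using b c l by (intro divide_left_mono mult_mono mult_pos_pos) auto
    \<comment> \<open>The numerator is raised to 4 so that its square root is 2.\<close>
    also have "\<dots> \<le> 4 / (real (Suc l) * real (n - l))"
      using l by (simp add: divide_simps mult.commute)
    finally have "sqrt (odds n l / (1 + excess * real l)\<^sup>2) \<le> sqrt (4 / (real (Suc l) * real (n - l)))"
      by (rule real_sqrt_le_mono)
    then show ?thesis using lf[of l] by (simp add: real_sqrt_divide real_sqrt_mult)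
  qed
  have "growth (\<lambda>l. sqrt (odds n l)) k \<le> (\<Prod>l<k. exp (2 * (1 + excess) * ?t l))"
    unfolding growth_def
  proof (rule prod_mono)
    fix l
    have "0 \<le> 2 * (1 + excess) * ?t l" using t0[of l] excess_ge_1 by (intro mult_nonneg_nonneg) auto
    then show "0 \<le> 1 + 2 * (1 + excess) * sqrt (odds n l) / (1 + excess * real l) \<and>
        1 + 2 * (1 + excess) * sqrt (odds n l) / (1 + excess * real l) \<le> exp (2 * (1 + excess) * ?t l)"
      using exp_ge_add_one_self[of "2 * (1 + excess) * ?t l"] by simp
  qed
  also have "\<dots> = exp (2 * (1 + excess) * (\<Sum>l<k. ?t l))"
    by (simp only: exp_sum[OF finite_lessThan, symmetric] sum_distrib_left)
  also have "(\<Sum>l<k. ?t l) \<le> (\<Sum>l<n. ?t l)"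
    using assms t0 by (intro sum_mono2) auto
  also have "(\<Sum>l<n. ?t l) \<le> 8"
  proof -
    have "(\<Sum>l<n. ?t l) \<le> (\<Sum>l<n. 2 * (1 / sqrt (real (Suc l) * real (n - l))))"
      using t by (intro sum_mono) auto
    also have "\<dots> \<le> 2 * 4"
      unfolding sum_distrib_left[symmetric] using sum_inverse_sqrt_mult_le[of n] by (intro mult_left_mono) auto
    finally show ?thesis by simp
  qed
  finally show ?thesis using excess_ge_1 by (simp add: mult_left_mono)
qed

theorem expect_prod_odds_le:
  "expect m (\<lambda>P. \<Sum>w\<in>nonroots P. \<Prod>x\<leftarrow>sizes P w. 2 * sqrt (odds (Suc m) x)) \<le> 10 * real d * exp (16 * (1 + excess))"
proof -
  let ?E = "exp (16 * (1 + excess))"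
  let ?h = "\<lambda>P w. 1 / (1 + excess * (real m - real (internals P w)))"
  have "expect m (\<lambda>P. \<Sum>w\<in>nonroots P. \<Prod>x\<leftarrow>sizes P w. 2 * sqrt (odds (Suc m) x)) \<le>
      expect m (\<lambda>P. \<Sum>w=1..d. 2 * sqrt (odds (Suc m) (internals P w)) * growth (\<lambda>x. sqrt (odds (Suc m) x)) (internals P w))"
    using odds_pos by (intro expect_prod_sizes_le) (simp add: less_imp_le)
  also have "\<dots> \<le> expect m (\<lambda>P. 2 * ?E * real d + 2 * ?E * (2 * (2 + excess * real m)) * (\<Sum>w=1..d. ?h P w))"
  proof (rule expect_mono)
    fix P assume h: "history d (Suc m) P"
    have "2 * sqrt (odds (Suc m) k) * growth (\<lambda>x. sqrt (odds (Suc m) x)) k \<le>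
        2 * ?E + 2 * ?E * (2 * (2 + excess * real m)) * (1 / (1 + excess * (real m - real k)))" if k: "k \<le> m" for k
    proof -
      have m: "real m \<le> excess * real m" using excess_ge_1 mult_right_mono[of 1 excess "real m"] by simp
      have "(1 + excess) * real k \<le> (1 + excess) * real m"
        using k excess_ge_1 by (intro mult_left_mono) auto
      also have "\<dots> = real m + excess * real m" by (simp add: algebra_simps)
      finally have num: "1 + (1 + excess) * real k \<le> 2 * (2 + excess * real m)" using m by simp
      have "excess * (real m - real k) \<le> (1 + excess) * real (Suc m - k)"
        using k excess_ge_1 by (intro mult_mono) auto
      then have den: "1 + excess * (real m - real k) \<le> 1 + (1 + excess) * real (Suc m - k)" by simp
      have dpos: "1 + excess * (real m - real k) > 0" using k excess_ge_1 by (intro add_pos_nonneg) auto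
      have "odds (Suc m) k \<le> 2 * (2 + excess * real m) / (1 + excess * (real m - real k))"
        unfolding odds_def using num den dpos excess_ge_1 by (intro frac_le) auto
      \<comment> \<open>Linearising the square root makes the exact mean in
        \<open>expect_root_children\<close> applicable.\<close>
      moreover have "sqrt (odds (Suc m) k) \<le> 1 + odds (Suc m) k"
        using odds_pos[of "Suc m" k] by (intro real_le_lsqrt) (auto simp: power2_eq_square algebra_simps)
      ultimately have g: "sqrt (odds (Suc m) k) \<le> 1 + 2 * (2 + excess * real m) * (1 / (1 + excess * (real m - real k)))"
        by simp
      have "growth (\<lambda>x. sqrt (odds (Suc m) x)) k \<le> ?E" using growth_odds_le k by simp
      moreover have "growth (\<lambda>x. sqrt (odds (Suc m) x)) k \<ge> 0"
        using growth_ge_1[of "\<lambda>x. sqrt (odds (Suc m) x)" k] odds_pos by (simp add: less_imp_le)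
      moreover have "0 \<le> 1 + 2 * (2 + excess * real m) * (1 / (1 + excess * (real m - real k)))"
        using odds_pos[of "Suc m" k] by (intro order_trans[OF _ g]) simp
      ultimately have bound: "sqrt (odds (Suc m) k) * growth (\<lambda>x. sqrt (odds (Suc m) x)) k \<le>
          (1 + 2 * (2 + excess * real m) * (1 / (1 + excess * (real m - real k)))) * ?E"
        by (intro mult_mono g)
      have alg: "2 * a * b \<le> 2 * E + 2 * E * c * h" if "a * b \<le> (1 + c * h) * E" for a b c h E :: real
        using that by (simp add: algebra_simps)
      show ?thesis by (rule alg[OF bound])
    qed
    moreover have "internals P w \<le> m" for w using internals_less[OF h, of w] by simp
    ultimately have "(\<Sum>w=1..d. 2 * sqrt (odds (Suc m) (internals P w)) * growth (\<lambda>x. sqrt (odds (Suc m) x)) (internals P w))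
        \<le> (\<Sum>w=1..d. 2 * ?E + 2 * ?E * (2 * (2 + excess * real m)) * ?h P w)"
      by (intro sum_mono) blast
    also have "\<dots> = 2 * ?E * real d + 2 * ?E * (2 * (2 + excess * real m)) * (\<Sum>w=1..d. ?h P w)"
      unfolding sum.distrib sum_distrib_left[symmetric] by simp
    finally show "(\<Sum>w=1..d. 2 * sqrt (odds (Suc m) (internals P w)) * growth (\<lambda>x. sqrt (odds (Suc m) x)) (internals P w))
        \<le> \<dots>" .
  qed
  also have "\<dots> = 2 * ?E * real d + 2 * ?E * (2 * (2 + excess * real m)) * (2 * real d / (2 + excess * real m))"
    unfolding expect_add expect_cmult expect_const expect_root_children ..
  also have "\<dots> = 10 * real d * ?E"
  proof -
    have "2 + excess * real m \<noteq> 0" using excess_ge_1 by (smt (verit) mult_nonneg_nonneg of_nat_0_le_iff)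
    then show ?thesis by (simp add: field_simps)
  qed
  finally show ?thesis .
qed

end


section \<open>Counting the nodes that are at least as central as the root\<close>

lemma half_powr_le:
  fixes \<eta> :: real
  assumes "0 < \<eta>" "\<eta> \<le> 1"
  shows "(1 / 2) powr \<eta> \<le> 1 - \<eta> / 4"
proof -
  have "\<eta> * (1 / 2) \<le> \<eta> * ln 2" using assms ln2_ge_two_thirds by (intro mult_left_mono) auto
  then have "1 + \<eta> / 2 \<le> exp (\<eta> * ln 2)" using exp_ge_add_one_self[of "\<eta> * ln 2"] by linarith
  then have "inverse (exp (\<eta> * ln 2)) \<le> inverse (1 + \<eta> / 2)" using assms by (intro le_imp_inverse_le) auto
  moreover have "(1 / 2) powr \<eta> = inverse (exp (\<eta> * ln 2))"
    by (simp add: powr_def ln_div exp_minus[symmetric])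
  moreover have "inverse (1 + \<eta> / 2) \<le> 1 - \<eta> / 4"
  proof -
    have "\<eta> * \<eta> \<le> \<eta> * 1" using assms by (intro mult_left_mono) auto
    then have "1 \<le> (1 - \<eta> / 4) * (1 + \<eta> / 2)" using assms by (simp add: algebra_simps)
    then show ?thesis using assms by (simp add: inverse_eq_divide pos_divide_le_eq)
  qed
  ultimately show ?thesis by linarith
qed

text \<open>If \<open>(x / 2) powr \<eta>\<close> exceeds \<open>1 / (2 * D)\<close>, then
  \<open>x\<close> exceeds \<open>2 * (2 * D) powr (- 1 / \<eta>)\<close>. From that point on, this
  constant makes a fraction \<open>\<eta> / 4\<close> of the linear term at least
  \<open>2 * D\<close>, the total of the constants 2 of up to \<open>D\<close> children. The
  fraction is the gain provided by \<open>half_powr_le\<close>.\<close>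

definition count_const :: "real \<Rightarrow> real \<Rightarrow> real" where
  "count_const D \<eta> = 4 * D / \<eta> * (2 * D) powr (1 / \<eta>)"

text \<open>The sum of the products of \<open>(x / 2) powr \<eta>\<close> along all paths below a node of relative size \<open>x\<close>
  satisfies a recursion over the children, for which \<open>2 + count_const D \<eta> * x\<close> is a supersolution:
  for \<open>(x / 2) powr \<eta> \<le> 1 / (2 * D)\<close> the constant \<open>2\<close> absorbs the sum, otherwise the linear term does.\<close>

lemma affine_supersolution:
  fixes x D \<eta> :: real
  assumes \<eta>: "0 < \<eta>" "\<eta> \<le> 1" and D: "D \<ge> 1" and C: "finite C" "real (card C) \<le> D"
    and x: "x \<le> 1" and y: "\<And>c. c \<in> C \<Longrightarrow> 0 \<le> y c" "(\<Sum>c\<in>C. y c) \<le> x"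
  shows "1 + (\<Sum>c\<in>C. (y c / 2) powr \<eta> * (2 + count_const D \<eta> * y c)) \<le> 2 + count_const D \<eta> * x"
proof -
  define A where "A = count_const D \<eta>"
  define p where "p = (x / 2) powr \<eta>"
  have A: "A \<ge> 0" using D \<eta> by (simp add: A_def count_const_def)
  have x0: "0 \<le> x" using sum_nonneg[of C y] y by force
  have p0: "p \<ge> 0" by (simp add: p_def)
  have Ax: "A * x \<ge> 0" using A x0 by simp
  have "(\<Sum>c\<in>C. (y c / 2) powr \<eta> * (2 + A * y c)) \<le> (\<Sum>c\<in>C. p * (2 + A * y c))"
  proof (rule sum_mono)
    fix c assume c: "c \<in> C"
    have "y c \<le> x" using member_le_sum[OF c, of y] y C by fastforce
    then have "(y c / 2) powr \<eta> \<le> p" unfolding p_def using y(1)[OF c] \<eta> by (intro powr_mono2) auto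
    then show "(y c / 2) powr \<eta> * (2 + A * y c) \<le> p * (2 + A * y c)"
      using A y(1)[OF c] by (intro mult_right_mono) auto
  qed
  also have "\<dots> = p * (2 * real (card C) + A * (\<Sum>c\<in>C. y c))"
    by (simp add: sum.distrib sum_distrib_left[symmetric] algebra_simps)
  also have "\<dots> \<le> p * (2 * D + A * x)"
    using p0 C(2) A y(2) by (intro mult_left_mono add_mono) auto
  finally have 1: "(\<Sum>c\<in>C. (y c / 2) powr \<eta> * (2 + A * y c)) \<le> p * (2 * D) + p * (A * x)"
    by (simp add: distrib_left)
  have "p \<le> (1 / 2) powr \<eta>" unfolding p_def using x x0 \<eta> by (intro powr_mono2) auto
  then have p1: "p \<le> 1 - \<eta> / 4" using half_powr_le[OF \<eta>] by simp
  show ?thesis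
  proof (cases "p * (2 * D) \<le> 1")
    case True
    have "p * (A * x) \<le> 1 * (A * x)" using p1 \<eta> Ax by (intro mult_right_mono) auto
    then show ?thesis using 1 True unfolding A_def by linarith
  next
    case False
    then have "1 / (2 * D) \<le> p" using D by (simp add: field_simps)
    then have "(1 / (2 * D)) powr (1 / \<eta>) \<le> p powr (1 / \<eta>)" using D \<eta> by (intro powr_mono2) auto
    also have "\<dots> = x / 2" using \<eta> x0 by (simp add: p_def powr_powr)
    finally have x2: "2 * (1 / (2 * D)) powr (1 / \<eta>) \<le> x" by simp
    have "(2 * D) powr (1 / \<eta>) * (1 / (2 * D)) powr (1 / \<eta>) = 1"
      using D by (simp add: powr_mult[symmetric])
    then have "8 * D / \<eta> = A * (2 * (1 / (2 * D)) powr (1 / \<eta>))"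
      by (simp add: A_def count_const_def)
    also have "\<dots> \<le> A * x" using x2 A by (rule mult_left_mono)
    finally have "8 * D / \<eta> * (\<eta> / 4) \<le> A * x * (\<eta> / 4)" using \<eta> by (intro mult_right_mono) auto
    then have "2 * D \<le> A * x * (\<eta> / 4)" using \<eta> by simp
    moreover have "p * (A * x) \<le> (1 - \<eta> / 4) * (A * x)" using p1 Ax by (intro mult_right_mono)
    moreover have "p * (2 * D) \<le> 1 * (2 * D)" using p1 \<eta> D by (intro mult_right_mono) auto
    ultimately show ?thesis using 1 unfolding A_def[symmetric] by (simp add: algebra_simps)
  qed
qed

text \<open>By \<open>affine_supersolution\<close>, the potential of each node pays 1 for the node
  and the potentials of its children. Summed over the tree, the potentials of all nodes but the root
  cancel, so neither depth nor size enters the bound.\<close>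

theorem sum_prod_sizes_powr_le:
  assumes P: "parent_list P" and D: "D \<ge> 1" and \<eta>: "0 < \<eta>" "\<eta> \<le> 1"
    and children: "\<And>v. real (card {c. 0 < c \<and> c < length P \<and> P ! c = v}) \<le> D"
  shows "(\<Sum>v<length P. \<Prod>x\<leftarrow>anc P v. (real (card (subtree P x)) / real (length P) / 2) powr \<eta>) \<le> 2 + count_const D \<eta>"
proof -
  let ?N = "length P"
  \<comment> \<open>Since \<open>subtree P 0\<close> is empty, the relative size 1 of the root is
    set by hand.\<close>
  define s where "s v = (if v = 0 then 1 else real (card (subtree P v)) / real ?N)" for v
  define q where "q v = (\<Prod>x\<leftarrow>anc P v. (real (card (subtree P x)) / real (length P) / 2) powr \<eta>)" for v
  define F where "F x = 2 + count_const D \<eta> * x" for x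
  let ?C = "\<lambda>v. {c. 0 < c \<and> c < ?N \<and> P ! c = v}"
  have N: "?N > 0" using P by (simp add: parent_list_def)
  have q0: "q v \<ge> 0" for v unfolding q_def by (intro prod_list_nonneg) auto
  have super: "1 + (\<Sum>c\<in>?C v. (s c / 2) powr \<eta> * F (s c)) \<le> F (s v)" if v: "v < ?N" for v
    unfolding F_def
  proof (rule affine_supersolution[OF \<eta> D _ children])
    show "s v \<le> 1" using card_subtree_less[OF P, of v] N by (simp add: s_def)
    have "(\<Sum>c\<in>?C v. s c) = real (\<Sum>c\<in>?C v. card (subtree P c)) / real ?N"
      by (simp add: s_def sum_divide_distrib)
    also have "\<dots> \<le> real (if v = 0 then ?N else card (subtree P v)) / real ?N"
      using sum_card_subtree_children[OF P v] by (intro divide_right_mono) (simp_all only: of_nat_le_iff of_nat_0_le_iff)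
    also have "\<dots> = s v" using N by (simp add: s_def)
    finally show "(\<Sum>c\<in>?C v. s c) \<le> s v" .
  qed (auto simp: s_def)
  have "(\<Sum>v<?N. q v) + (\<Sum>v<?N. \<Sum>c\<in>?C v. q c * F (s c)) = (\<Sum>v<?N. q v * (1 + (\<Sum>c\<in>?C v. (s c / 2) powr \<eta> * F (s c))))"
  proof -
    have "(\<Sum>c\<in>?C v. q c * F (s c)) = q v * (\<Sum>c\<in>?C v. (s c / 2) powr \<eta> * F (s c))" for v
      unfolding sum_distrib_left
      by (intro sum.cong refl) (auto simp: q_def s_def anc_pos[OF P])
    then show ?thesis by (simp add: sum.distrib distrib_left)
  qed
  also have "\<dots> \<le> (\<Sum>v<?N. q v * F (s v))"
    using super q0 by (intro sum_mono mult_left_mono) auto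
  also have "\<dots> = q 0 * F (s 0) + (\<Sum>c\<in>{0<..<?N}. q c * F (s c))"
  proof -
    have "{..<?N} = insert 0 {0<..<?N}" using N by auto
    then show ?thesis by simp
  qed
  also have "(\<Sum>c\<in>{0<..<?N}. q c * F (s c)) = (\<Sum>v<?N. \<Sum>c\<in>?C v. q c * F (s c))"
  proof -
    have "(\<Sum>v<?N. sum (\<lambda>c. q c * F (s c)) {c \<in> {0<..<?N}. P ! c = v}) = (\<Sum>c\<in>{0<..<?N}. q c * F (s c))"
      using parent_less_length[OF P] by (intro sum.group) auto
    then show ?thesis by (simp add: conj_assoc)
  qed
  finally have "(\<Sum>v<?N. q v) \<le> q 0 * F (s 0)" by simp
  then show ?thesis by (simp add: q_def s_def F_def)
qed

section \<open>From the number of competitors to the failure probability\<close>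

lemma prob_bind_pmf:
  assumes "integrable (measure_pmf p) (\<lambda>x. measure_pmf.prob (f x) X)"
  shows "measure_pmf.prob (bind_pmf p f) X = measure_pmf.expectation p (\<lambda>x. measure_pmf.prob (f x) X)"
proof -
  have "ennreal (measure_pmf.prob (bind_pmf p f) X) = (\<integral>\<^sup>+x. ennreal (measure_pmf.prob (f x) X) \<partial>p)"
    by (simp add: measure_pmf.emeasure_eq_measure[symmetric])
  also have "\<dots> = ennreal (measure_pmf.expectation p (\<lambda>x. measure_pmf.prob (f x) X))"
    using assms by (intro nn_integral_eq_integral) auto
  finally show ?thesis by (simp add: integral_nonneg)
qed

context regular_attachment
begin

text \<open>Ties count as rivals, because they may be broken against the root.\<close>

definition rivals :: "nat list \<Rightarrow> nat set" where
  "rivals P = {w \<in> nonroots P. centrality (graph_of P) w \<le> centrality (graph_of P) 0}"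

lemma history_odds:
  assumes h: "history d n P" and w: "0 < w" "w < length P"
  shows "real (card (subtree P w)) / real (length P - card (subtree P w)) = odds n (internals P w)"
proof -
  let ?k = "internals P w"
  have k: "?k < n" using internals_less[OF h] .
  have "length P - card (subtree P w) = 1 + (d - 1) * (n - ?k)"
    using history_length[OF h] history_card_subtree[OF h w] k by (simp add: diff_mult_distrib2 Suc_diff_le)
  then show ?thesis
    using history_card_subtree[OF h w] by (simp add: odds_def real_d_minus_1[symmetric])
qed

text \<open>Each rival contributes at least \<open>M powr (- 4 * \<eta>)\<close> to the sum bounded
  by \<open>sum_prod_sizes_powr_le\<close>.\<close>

lemma card_rivals_le:
  assumes h: "history d n P" and M: "M \<ge> 1" and \<eta>: "0 < \<eta>" "\<eta> \<le> 1"
    and S: "(\<Sum>w\<in>nonroots P. \<Prod>x\<leftarrow>sizes P w. 2 * sqrt (odds n x)) \<le> M"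
  shows "real (card (rivals P)) \<le> (2 + count_const (real d) \<eta>) * M powr (4 * \<eta>)"
proof -
  let ?N = "length P"
  have P: "parent_list P" using history_parent_list[OF h] .
  define r where "r u = odds n (internals P u)" for u
  define x where "x u = real (card (subtree P u)) / real ?N" for u
  have r0: "r u > 0" for u by (simp add: r_def odds_pos)
  have anc_prod: "(\<Prod>u\<leftarrow>anc P w. f u) = (\<Prod>u\<in>set (anc P w). f u)" if "w < ?N" for f :: "nat \<Rightarrow> real" and w
    by (rule prod.distinct_set_conv_list[OF distinct_anc[OF P that], symmetric])
  have anc_lt: "0 < u" "u < ?N" if "u \<in> set (anc P w)" "w < ?N" for u w
    using anc_bounds[OF that(1)] that(2) by auto
  have a: "(\<Prod>u\<in>set (anc P w). 4 * r u) \<le> M\<^sup>2" if w: "w < ?N" for w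
  proof (cases "w = 0")
    case True
    then show ?thesis using M by simp
  next
    case False
    let ?p = "\<lambda>w. \<Prod>x\<leftarrow>sizes P w. 2 * sqrt (odds n x)"
    have p0: "?p w \<ge> 0" for w using odds_pos by (intro prod_list_nonneg) (auto simp: less_imp_le)
    have "?p w \<le> (\<Sum>w\<in>nonroots P. ?p w)"
      using w False p0 by (intro member_le_sum) (auto simp: nonroots_def)
    then have "?p w \<le> M" using S by simp
    then have "(?p w)\<^sup>2 \<le> M\<^sup>2" using p0 by (intro power_mono)
    moreover have "?p w = (\<Prod>u\<in>set (anc P w). 2 * sqrt (r u))"
      using anc_prod[OF w, of "\<lambda>u. 2 * sqrt (r u)"] by (simp add: sizes_def r_def comp_def)
    moreover have "(\<Prod>u\<in>set (anc P w). 2 * sqrt (r u))\<^sup>2 = (\<Prod>u\<in>set (anc P w). 4 * r u)"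
      unfolding prod_power_distrib using r0 by (intro prod.cong refl) (simp add: power_mult_distrib less_imp_le)
    ultimately show ?thesis by simp
  qed
  \<comment> \<open>Odds decrease away from the root, so those of at least 1 form the part of the
    path next to the root. At the lowest such node every maximum is at most \<open>4 * r u\<close>
    and \<open>a\<close> applies; further down the maxima are 1.\<close>
  have b: "(\<Prod>u\<in>set (anc P w). max 1 (r u)) \<le> M\<^sup>2" if w: "w < ?N" for w
    using P w
  proof (induction w rule: parent_list_induct)
    case root
    then show ?case using M by simp
  next
    case (node w)
    show ?case
    proof (cases "r w \<ge> 1")
      case True
      have "max 1 (r u) \<le> 4 * r u" if u: "u \<in> set (anc P w)" for u
      proof -
        have "card (subtree P w) \<le> card (subtree P u)"
          using subtree_mono[OF P node(2) u] by (intro card_mono) auto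
        moreover have "card (subtree P u) < ?N" by (rule card_subtree_less[OF P])
        ultimately have "real (card (subtree P w)) / real (?N - card (subtree P w)) \<le>
            real (card (subtree P u)) / real (?N - card (subtree P u))" by (intro frac_le) auto
        then have "r w \<le> r u"
          unfolding r_def using history_odds[OF h] node(1,2) anc_lt[OF u node(2)] by simp
        then show ?thesis using True by simp
      qed
      then have "(\<Prod>u\<in>set (anc P w). max 1 (r u)) \<le> (\<Prod>u\<in>set (anc P w). 4 * r u)"
        by (intro prod_mono) auto
      then show ?thesis using a[OF node(2)] by simp
    next
      case False
      have "w \<notin> set (anc P (P ! w))" using anc_bounds[of w P "P ! w"] node(3) by auto
      then show ?thesis using node False by simp
    qed
  qed
  have c: "(\<Prod>u\<in>set (anc P w). (x u / 2) powr \<eta>) \<ge> M powr (- 4 * \<eta>)" if w: "w \<in> rivals P" for w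
  proof -
    have wN: "0 < w" "w < ?N" using w by (auto simp: rivals_def nonroots_def)
    let ?S = "set (anc P w)"
    have "real (centrality (graph_of P) 0) = real (centrality (graph_of P) w) *
      (\<Prod>u\<leftarrow>anc P w. real (card (subtree P u)) / real (?N - card (subtree P u)))"
      by (rule centrality_ratio[OF P wN(2)])
    also have "(\<Prod>u\<leftarrow>anc P w. real (card (subtree P u)) / real (?N - card (subtree P u))) = (\<Prod>u\<in>?S. r u)"
      unfolding anc_prod[OF wN(2)] r_def using history_odds[OF h] anc_lt wN by (intro prod.cong refl) blast
    finally have "real (centrality (graph_of P) w) * 1 \<le> real (centrality (graph_of P) w) * (\<Prod>u\<in>?S. r u)"
      using w by (simp add: rivals_def)
    moreover have "real (centrality (graph_of P) w) > 0"
      using centrality_pos[OF finite_tree_graph_of[OF P]] wN by (simp add: graph_of_def)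
    ultimately have prod_r: "1 \<le> (\<Prod>u\<in>?S. r u)" by (simp only: mult_le_cancel_left_pos)
    have "1 / M ^ 4 = 1 / (M\<^sup>2 * M\<^sup>2)" by (simp add: power_add[symmetric])
    \<comment> \<open>The product of the fours is at most \<open>M ^ 2\<close> because inserting the
      odds, whose product is at least 1, turns it into the product in \<open>a\<close>.\<close>
    also have "\<dots> \<le> (\<Prod>u\<in>?S. r u) / ((\<Prod>u\<in>?S. 4) * (\<Prod>u\<in>?S. max 1 (r u)))"
    proof (intro frac_le mult_mono prod_nonneg mult_pos_pos prod_pos)
      have "(\<Prod>u\<in>?S. 4 :: real) * 1 \<le> (\<Prod>u\<in>?S. 4) * (\<Prod>u\<in>?S. r u)"
        using prod_r by (intro mult_left_mono prod_nonneg) auto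
      also have "\<dots> \<le> M\<^sup>2" using a[OF wN(2)] by (simp only: prod.distrib)
      finally show "(\<Prod>u\<in>?S. 4 :: real) \<le> M\<^sup>2" by simp
    qed (use prod_r b[OF wN(2)] r0 in \<open>auto simp: less_imp_le\<close>)
    also have "\<dots> = (\<Prod>u\<in>?S. r u / (4 * max 1 (r u)))"
      by (simp only: prod_dividef prod.distrib)
    also have "\<dots> \<le> (\<Prod>u\<in>?S. x u / 2)"
    proof (rule prod_mono)
      fix u assume u: "u \<in> ?S"
      define a where "a = real (card (subtree P u))"
      define b where "b = real (?N - card (subtree P u))"
      have N: "card (subtree P u) < ?N" by (rule card_subtree_less[OF P])
      then have ab: "a \<ge> 0" "b > 0" "real ?N = a + b" by (simp_all add: a_def b_def)
      have ru: "r u = a / b"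
        unfolding r_def a_def b_def using history_odds[OF h] anc_lt[OF u wN(2)] by simp
      \<comment> \<open>If \<open>a \<ge> b\<close>, the left side is 1/4 and the subtree makes up
        at least half of the tree; otherwise \<open>a + b \<le> 2 * b\<close>.\<close>
      have "r u / (4 * max 1 (r u)) \<le> x u / 2"
      proof (cases "a \<ge> b")
        case True
        then show ?thesis using ab by (simp add: ru x_def a_def[symmetric] max_def divide_simps)
      next
        case False
        then have "a * (2 * (a + b)) \<le> a * (4 * b)" using ab by (intro mult_left_mono) auto
        then show ?thesis using ab False
          by (simp add: ru x_def a_def[symmetric] max_def divide_simps) (simp add: algebra_simps)
      qed
      then show "0 \<le> r u / (4 * max 1 (r u)) \<and> r u / (4 * max 1 (r u)) \<le> x u / 2"
        using r0[of u] by simp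
    qed
    finally have "(1 / M ^ 4) powr \<eta> \<le> (\<Prod>u\<in>?S. x u / 2) powr \<eta>"
      using M \<eta> by (intro powr_mono2) auto
    moreover have "(1 / M ^ 4) powr \<eta> = M powr (- 4 * \<eta>)"
    proof -
      have "1 / M ^ 4 = M powr (- 4)" using M by (simp add: powr_minus powr_numeral divide_inverse)
      then show ?thesis by (simp add: powr_powr)
    qed
    ultimately show ?thesis
      by (simp add: prod_powr_distrib x_def)
  qed
  have fin: "finite (rivals P)" by (simp add: rivals_def)
  have "real (card (rivals P)) * M powr (- 4 * \<eta>) = (\<Sum>w\<in>rivals P. M powr (- 4 * \<eta>))" by simp
  also have "\<dots> \<le> (\<Sum>w\<in>rivals P. \<Prod>u\<in>set (anc P w). (x u / 2) powr \<eta>)"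
    by (rule sum_mono[OF c])
  also have "\<dots> \<le> (\<Sum>w<?N. \<Prod>u\<in>set (anc P w). (x u / 2) powr \<eta>)"
    by (intro sum_mono2 prod_nonneg) (auto simp: rivals_def nonroots_def)
  also have "\<dots> = (\<Sum>w<?N. \<Prod>u\<leftarrow>anc P w. (x u / 2) powr \<eta>)"
    by (intro sum.cong refl) (simp add: anc_prod)
  also have "\<dots> \<le> 2 + count_const (real d) \<eta>"
    unfolding x_def using history_children(1)[OF h] d by (intro sum_prod_sizes_powr_le[OF P _ \<eta>]) auto
  finally have "real (card (rivals P)) * M powr (- 4 * \<eta>) * M powr (4 * \<eta>) \<le> (2 + count_const (real d) \<eta>) * M powr (4 * \<eta>)"
    by (intro mult_right_mono) auto
  moreover have "M powr (- 4 * \<eta>) * M powr (4 * \<eta>) = 1" using M by (simp add: powr_add[symmetric])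
  ultimately show ?thesis by (simp add: mult.assoc)
qed

text \<open>A missing root stands behind the first \<open>k\<close> nodes of the sorted list, so
  these are all rivals.\<close>

lemma algorithm_output_misses_root:
  assumes P: "parent_list P" and S: "S \<in> algorithm_outputs k (graph_of P)" "root_node \<notin> S"
  shows "k \<le> card (rivals P)"
proof -
  obtain vs where vs: "S = set (take k vs)" "distinct vs" "set vs = verts (graph_of P)"
      "sorted (map (centrality (graph_of P)) vs)"
    using S(1) unfolding algorithm_outputs_def by blast
  have "0 \<in> set vs" using P vs(3) by (simp add: graph_of_def parent_list_def)
  then obtain i where i: "i < length vs" "vs ! i = 0" by (auto simp: in_set_conv_nth)
  have "k \<le> i"
  proof (rule ccontr)
    assume "\<not> k \<le> i"
    then have "vs ! i \<in> set (take k vs)" using i(1) by (auto simp: in_set_conv_nth intro!: exI[of _ i])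
    then show False using i(2) S(2) vs(1) by (simp add: root_node_def)
  qed
  have "set (take k vs) \<subseteq> rivals P"
  proof
    fix w assume "w \<in> set (take k vs)"
    then obtain j where j: "j < k" "j < length vs" "w = vs ! j" by (auto simp: in_set_conv_nth)
    then have "w \<noteq> 0" using \<open>k \<le> i\<close> i vs(2) by (metis less_le_trans less_irrefl nth_eq_iff_index_eq)
    moreover have "w < length P" using j vs(3) nth_mem[OF j(2)] by (simp add: graph_of_def)
    moreover have "centrality (graph_of P) w \<le> centrality (graph_of P) 0"
      using sorted_nth_mono[OF vs(4), of j i] j i \<open>k \<le> i\<close> by simp
    ultimately show "w \<in> rivals P" by (simp add: rivals_def nonroots_def)
  qed
  moreover have "finite (rivals P)" by (simp add: rivals_def)
  ultimately have "card (set (take k vs)) \<le> card (rivals P)" by (intro card_mono)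
  then show ?thesis using vs(2) \<open>k \<le> i\<close> i(1) by (simp add: distinct_card)
qed

lemma prob_miss_le:
  assumes A: "is_algorithm k A" and M: "M \<ge> 1" and \<eta>: "0 < \<eta>" "\<eta> \<le> 1"
    and k: "real k > (2 + count_const (real d) \<eta>) * M powr (4 * \<eta>)"
  shows "measure_pmf.prob (bind_pmf (UA d (Suc m)) A) {S. root_node \<notin> S} \<le> 10 * real d * exp (16 * (1 + excess)) / M"
proof -
  let ?X = "\<lambda>P. \<Sum>w\<in>nonroots P. \<Prod>x\<leftarrow>sizes P w. 2 * sqrt (odds (Suc m) x)"
  have "bind_pmf (UA d (Suc m)) A = bind_pmf (parent_process m) (\<lambda>P. A (graph_of P))"
    by (simp add: UA_parent_process bind_map_pmf)
  then have "measure_pmf.prob (bind_pmf (UA d (Suc m)) A) {S. root_node \<notin> S} =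
      expect m (\<lambda>P. measure_pmf.prob (A (graph_of P)) {S. root_node \<notin> S})"
    by (simp add: prob_bind_pmf expect_def integrable_parent_process)
  also have "\<dots> \<le> expect m (\<lambda>P. ?X P / M)"
  proof (rule expect_mono)
    fix P assume h: "history d (Suc m) P"
    have P: "parent_list P" using history_parent_list[OF h] .
    have X0: "?X P \<ge> 0" using odds_pos by (intro sum_nonneg prod_list_nonneg) (auto simp: less_imp_le)
    \<comment> \<open>Markov's inequality in pointwise form: given the tree, the failure probability
      is 0 if the sum is at most \<open>M\<close>, and otherwise at most 1, which is below the
      quotient.\<close>
    show "measure_pmf.prob (A (graph_of P)) {S. root_node \<notin> S} \<le> ?X P / M"
    proof (cases "?X P \<le> M")
      case True
      have "real (card (rivals P)) < real k" using card_rivals_le[OF h M \<eta> True] k by simp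
      then have "root_node \<in> S" if "S \<in> set_pmf (A (graph_of P))" for S
        using algorithm_output_misses_root[OF P, of S k] A finite_tree_graph_of[OF P] that
        by (fastforce simp: is_algorithm_def)
      then have "set_pmf (A (graph_of P)) \<inter> {S. root_node \<notin> S} = {}" by blast
      then have "measure_pmf.prob (A (graph_of P)) {S. root_node \<notin> S} = 0"
        by (simp add: measure_pmf_zero_iff)
      then show ?thesis using X0 M by simp
    next
      case False
      then have "1 \<le> ?X P / M" using M by simp
      then show ?thesis using measure_pmf.prob_le_1 order_trans by blast
    qed
  qed
  also have "\<dots> \<le> 10 * real d * exp (16 * (1 + excess)) / M"
    unfolding expect_divide using expect_prod_odds_le M by (intro divide_right_mono) auto
  finally show ?thesis .
qed

text \<open>The exponent \<open>5 + ln (2 * real d)\<close> collects \<open>4 * t\<close> from the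
  power of \<open>1 / \<epsilon>\<close>, \<open>t\<close> from
  \<open>1 / \<eta> = 1 + t \<le> exp t\<close>, and \<open>ln (2 * real d) * t\<close> from the
  power \<open>1 / \<eta>\<close> in \<open>count_const\<close>. The 3 in place of 2 makes the
  inequality strict.\<close>

lemma rivals_threshold:
  fixes t \<epsilon> C0 :: real
  assumes C0: "C0 \<ge> 1" and t: "t > 0" and \<epsilon>: "\<epsilon> = exp (- t\<^sup>2)"
  shows "(2 + count_const (real d) (1 / (1 + t))) * (C0 / \<epsilon>) powr (4 * (1 / (1 + t))) <
    (3 + 8 * (real d)\<^sup>2) * C0 ^ 4 * exp ((5 + ln (2 * real d)) * t)"
proof -
  let ?\<eta> = "1 / (1 + t)" and ?D = "2 * real d"
  have D: "?D > 1" using d by simp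
  have \<eta>: "?\<eta> \<le> 1" using t by simp
  have "(C0 / \<epsilon>) powr (4 * ?\<eta>) = C0 powr (4 * ?\<eta>) * exp (t\<^sup>2) powr (4 * ?\<eta>)"
    using C0 unfolding \<epsilon> by (simp add: exp_minus divide_inverse powr_mult)
  also have "\<dots> \<le> C0 ^ 4 * exp (4 * t)"
  proof (intro mult_mono)
    have "C0 powr (4 * ?\<eta>) \<le> C0 powr 4" using C0 \<eta> by (intro powr_mono) auto
    then show "C0 powr (4 * ?\<eta>) \<le> C0 ^ 4" using C0 by (simp add: powr_numeral)
    have "t\<^sup>2 * (4 * ?\<eta>) \<le> 4 * t" using t by (simp add: power2_eq_square divide_simps)
    then show "exp (t\<^sup>2) powr (4 * ?\<eta>) \<le> exp (4 * t)" by (simp add: powr_def mult.commute)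
  qed (use C0 in auto)
  finally have 1: "(C0 / \<epsilon>) powr (4 * ?\<eta>) \<le> C0 ^ 4 * exp (4 * t)" .
  have 2: "2 + count_const (real d) ?\<eta> \<le> (2 + 8 * (real d)\<^sup>2) * exp ((1 + ln ?D) * t)"
  proof -
    have "count_const (real d) ?\<eta> = 4 * real d * (1 + t) * ?D powr (1 + t)"
      by (simp add: count_const_def)
    also have "?D powr (1 + t) = ?D * exp (ln ?D * t)"
      using D by (simp add: powr_add powr_def[of _ t] mult.commute)
    also have "4 * real d * (1 + t) * (?D * exp (ln ?D * t)) = 8 * (real d)\<^sup>2 * ((1 + t) * exp (ln ?D * t))"
      by (simp add: power2_eq_square)
    also have "\<dots> \<le> 8 * (real d)\<^sup>2 * (exp t * exp (ln ?D * t))"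
      by (intro mult_left_mono mult_right_mono) auto
    also have "exp t * exp (ln ?D * t) = exp ((1 + ln ?D) * t)"
      by (simp add: exp_add[symmetric] distrib_right)
    finally have "count_const (real d) ?\<eta> \<le> 8 * (real d)\<^sup>2 * exp ((1 + ln ?D) * t)" .
    moreover have "exp ((1 + ln ?D) * t) \<ge> 1" using D t by simp
    moreover have "(2 + 8 * (real d)\<^sup>2) * exp ((1 + ln ?D) * t) =
        2 * exp ((1 + ln ?D) * t) + 8 * (real d)\<^sup>2 * exp ((1 + ln ?D) * t)" by (rule distrib_right)
    ultimately show ?thesis by linarith
  qed
  have "(2 + count_const (real d) ?\<eta>) * (C0 / \<epsilon>) powr (4 * ?\<eta>) \<le>
      (2 + 8 * (real d)\<^sup>2) * exp ((1 + ln ?D) * t) * (C0 ^ 4 * exp (4 * t))"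
    using 1 2 by (intro mult_mono) auto
  also have "\<dots> = (2 + 8 * (real d)\<^sup>2) * (C0 ^ 4 * exp ((5 + ln ?D) * t))"
  proof -
    have "exp ((5 + ln ?D) * t) = exp ((1 + ln ?D) * t) * exp (4 * t)"
      by (simp add: exp_add[symmetric] distrib_right)
    then show ?thesis by simp
  qed
  also have "\<dots> < (3 + 8 * (real d)\<^sup>2) * (C0 ^ 4 * exp ((5 + ln ?D) * t))"
    using C0 by (intro mult_strict_right_mono mult_pos_pos) auto
  finally show ?thesis by (simp add: mult.assoc)
qed

end

theorem theorem1p2:
  fixes d :: nat
  assumes "d \<ge> 3"
  shows "\<exists>C c :: real. C > 0 \<and> c > 0 \<and>
    (\<forall>\<epsilon> :: real. \<epsilon> > 0 \<longrightarrow>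
      (let K = C * exp (c * sqrt (ln (1 / \<epsilon>))) in
       \<forall>n :: nat. n \<ge> 1 \<longrightarrow>
         (\<forall>A. is_algorithm (nat \<lceil>K\<rceil>) A \<longrightarrow>
            measure_pmf.prob (bind_pmf (UA d n) A) {S. root_node \<notin> S} \<le> \<epsilon>)))"
proof -
  interpret regular_attachment d by unfold_locales (rule assms)
  define C0 where "C0 = 10 * real d * exp (16 * (1 + excess))"
  have "1 * 1 \<le> 10 * real d * exp (16 * (1 + excess))"
    using assms excess_ge_1 by (intro mult_mono) auto
  then have C0: "C0 \<ge> 1" by (simp add: C0_def)
  define C where "C = (3 + 8 * (real d)\<^sup>2) * C0 ^ 4"
  define c where "c = 5 + ln (2 * real d)"
  have "C > 0" unfolding C_def using C0 by (intro mult_pos_pos add_pos_nonneg) auto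
  moreover have "c > 0" using assms by (simp add: c_def add_pos_nonneg)
  moreover have "measure_pmf.prob (bind_pmf (UA d n) A) {S. root_node \<notin> S} \<le> \<epsilon>"
    if \<epsilon>: "\<epsilon> > 0" and n: "n \<ge> 1" and A: "is_algorithm (nat \<lceil>C * exp (c * sqrt (ln (1 / \<epsilon>)))\<rceil>) A" for \<epsilon> n A
  proof (cases "\<epsilon> < 1")
    \<comment> \<open>For \<open>\<epsilon> \<ge> 1\<close> the bound is trivial; in the other case
      \<open>ln (1 / \<epsilon>)\<close> is positive.\<close>
    case False
    then show ?thesis using measure_pmf.prob_le_1 order_trans by (meson not_less)
  next
    case True
    define t where "t = sqrt (ln (1 / \<epsilon>))"
    have t: "t > 0" using \<epsilon> True by (simp add: t_def)
    have "t\<^sup>2 = - ln \<epsilon>" using \<epsilon> True by (simp add: t_def ln_div)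
    then have eps: "\<epsilon> = exp (- t\<^sup>2)" using \<epsilon> by simp
    obtain m where m: "n = Suc m" using n by (cases n) auto
    have "(2 + count_const (real d) (1 / (1 + t))) * (C0 / \<epsilon>) powr (4 * (1 / (1 + t))) < C * exp (c * t)"
      unfolding C_def c_def by (rule rivals_threshold[OF C0 t eps])
    also have "\<dots> \<le> real (nat \<lceil>C * exp (c * t)\<rceil>)" by (rule real_nat_ceiling_ge)
    finally have k: "(2 + count_const (real d) (1 / (1 + t))) * (C0 / \<epsilon>) powr (4 * (1 / (1 + t))) <
        real (nat \<lceil>C * exp (c * t)\<rceil>)" .
    have "C0 / \<epsilon> \<ge> 1" using C0 \<epsilon> True by (simp add: pos_le_divide_eq)
    then have "measure_pmf.prob (bind_pmf (UA d (Suc m)) A) {S. root_node \<notin> S} \<le> C0 / (C0 / \<epsilon>)"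
      using prob_miss_le[OF A[folded t_def] _ _ _ k] t by (simp add: C0_def)
    then show ?thesis using C0 by (simp add: m)
  qed
  ultimately show ?thesis unfolding Let_def by blast
qed

end
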